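(* Let $r,n$ be positive integers and let $p,p',q,q'$ be positive divisors of $r$ such that $pq=p'q'$ divides $rn$. Then $G(r,p,q,n)\cong G(r,p',q',n)$ if and only if either (i) $\mathrm{GCD}(p,n)=\mathrm{GCD}(p',n)$ and $\mathrm{GCD}(q,n)=\mathrm{GCD}(q',n)$, or (ii) $n=2$ and the numbers $p+p'$, $q+q'$ and $\frac{r}{pq}$ are all odd integers.
   Context: For a positive integer $r$ let $\zeta_r=\exp(2\pi\sqrt{-1}/r)$ and $\mathbb{Z}_r=\mathbb{Z}/r\mathbb{Z}$. $G(r,n)$ is the group of $n\times n$ complex matrices with exactly one nonzero entry in each row and column, each nonzero entry an $r$th root of unity; its elements are written $(\pi,x)$ with $\pi\in S_n$, $x\in(\mathbb{Z}_r)^n$, meaning the matrix whose $i$th column has $\zeta_r^{x_i}$ in row $\pi(i)$. Put $\Delta(\pi,x)=\sum_i x_i\in\mathbb{Z}_r$. For $p\mid r$, $G(r,p,n)=\{g\in G(r,n):\Delta(g)\in p\mathbb{Z}_r\}$. With $c=\zeta_rI_n$, when $p,q\mid r$ and $pq\mid rn$ the group $C_q=\langle c^{r/q}\rangle$ is a central subgroup of order $q$ of $G(r,p,n)$, and $G(r,p,q,n):=G(r,p,n)/C_q$. *)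

theory Defs
  imports
    "HOL-Analysis.Complex_Transcendental"
    "HOL-Algebra.Coset"
    "HOL-Algebra.Generated_Groups"
    "HOL-Combinatorics.Permutations"
    "HOL-Number_Theory.Cong"
    "Jordan_Normal_Form.Matrix"
begin

definition root_of_1 :: "nat \<Rightarrow> complex" where
  "root_of_1 r = exp (2 * of_real pi * \<i> / of_nat r)"

definition G_rn :: "nat \<Rightarrow> nat \<Rightarrow> complex mat monoid" where
  "G_rn r n =
    \<lparr>carrier = {A \<in> carrier_mat n n.
        (\<forall>i<n. \<exists>!j. j < n \<and> A $$ (i, j) \<noteq> 0) \<and>
        (\<forall>j<n. \<exists>!i. i < n \<and> A $$ (i, j) \<noteq> 0) \<and>
        (\<forall>i<n. \<forall>j<n. A $$ (i, j) \<noteq> 0 \<longrightarrow> A $$ (i, j) ^ r = 1)},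
     monoid.mult = (*),
     monoid.one = 1\<^sub>m n\<rparr>"

text \<open>The matrix written \<open>(\<pi>, x)\<close>.  Rows and columns are numbered \<open>0, \<dots>, n - 1\<close>, and
  an element of \<open>\<int>\<^sub>r\<close> is given by any natural number representing its residue class.\<close>

definition pair_mat :: "nat \<Rightarrow> nat \<Rightarrow> (nat \<Rightarrow> nat) \<Rightarrow> (nat \<Rightarrow> nat) \<Rightarrow> complex mat" where
  "pair_mat r n \<pi> x = mat n n (\<lambda>(i, j). if i = \<pi> j then root_of_1 r ^ x j else 0)"

text \<open>The value of \<open>\<Delta>\<close>, an element of \<open>\<int>\<^sub>r\<close>, is given by its representative in \<open>{0..<r}\<close>.
  See lemma \<open>Delta_pair_mat\<close> below for the uniqueness of the described number.\<close>

definition Delta :: "nat \<Rightarrow> nat \<Rightarrow> complex mat \<Rightarrow> nat" where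
  "Delta r n A = (THE d. \<exists>\<pi> x. \<pi> permutes {..<n} \<and> A = pair_mat r n \<pi> x \<and>
                                 d = (\<Sum>i<n. x i) mod r)"

text \<open>The subgroup \<open>p\<int>\<^sub>r\<close> of \<open>\<int>\<^sub>r\<close>, in terms of representatives in \<open>{0..<r}\<close>.\<close>

definition multiples_mod :: "nat \<Rightarrow> nat \<Rightarrow> nat set" where
  "multiples_mod p r = {(p * k) mod r | k. True}"

definition G_rpn :: "nat \<Rightarrow> nat \<Rightarrow> nat \<Rightarrow> complex mat monoid" where
  "G_rpn r p n =
    (G_rn r n)\<lparr>carrier := {A \<in> carrier (G_rn r n). Delta r n A \<in> multiples_mod p r}\<rparr>"

definition central_elt :: "nat \<Rightarrow> nat \<Rightarrow> complex mat" where
  "central_elt r n = root_of_1 r \<cdot>\<^sub>m 1\<^sub>m n"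

definition C_q :: "nat \<Rightarrow> nat \<Rightarrow> nat \<Rightarrow> complex mat set" where
  "C_q r q n = generate (G_rn r n) {central_elt r n [^]\<^bsub>G_rn r n\<^esub> (r div q)}"

text \<open>Meaningful when \<open>p\<close> and \<open>q\<close> divide \<open>r\<close> and \<open>p * q\<close> divides \<open>r * n\<close>, so that
  \<open>C_q r q n\<close> is a central subgroup of \<open>G_rpn r p n\<close>.\<close>

definition G_rpqn :: "nat \<Rightarrow> nat \<Rightarrow> nat \<Rightarrow> nat \<Rightarrow> complex mat set monoid" where
  "G_rpqn r p q n = G_rpn r p n Mod C_q r q n"

lemma root_of_1_neq_0: "root_of_1 r \<noteq> 0"
  by (simp add: root_of_1_def)

lemma root_of_1_power_eq_iff:
  assumes "r > 0"
  shows "root_of_1 r ^ a = root_of_1 r ^ b \<longleftrightarrow> [a = b] (mod r)"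
proof -
  have pow: "root_of_1 r ^ a = exp (2 * of_real pi * \<i> * of_nat a / of_nat r)" for a
    by (simp add: root_of_1_def flip: exp_of_nat_mult) (simp add: mult_ac)
  show ?thesis
    unfolding pow using assms complex_root_unity_eq [of r a b]
    by (simp add: cong_def mult_ac)
qed

lemma Delta_pair_mat:
  assumes "r > 0" and \<pi>: "\<pi> permutes {..<n}"
  shows "Delta r n (pair_mat r n \<pi> x) = (\<Sum>i<n. x i) mod r"
  unfolding Delta_def
proof (rule the_equality)
  show "\<exists>\<pi>' x'. \<pi>' permutes {..<n} \<and> pair_mat r n \<pi> x = pair_mat r n \<pi>' x' \<and>
          (\<Sum>i<n. x i) mod r = (\<Sum>i<n. x' i) mod r"
    using \<pi> by blast
next
  fix d
  assume "\<exists>\<pi>' x'. \<pi>' permutes {..<n} \<and> pair_mat r n \<pi> x = pair_mat r n \<pi>' x' \<and>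
            d = (\<Sum>i<n. x' i) mod r"
  then obtain \<pi>' x' where eq: "pair_mat r n \<pi> x = pair_mat r n \<pi>' x'"
    and d: "d = (\<Sum>i<n. x' i) mod r" by blast
  have "[x' j = x j] (mod r)" if "j < n" for j
  proof -
    have lt: "\<pi> j < n" using permutes_in_image [OF \<pi>, of j] that by simp
    have "pair_mat r n \<pi> x $$ (\<pi> j, j) = pair_mat r n \<pi>' x' $$ (\<pi> j, j)"
      by (simp only: eq)
    then have "root_of_1 r ^ x j = root_of_1 r ^ x' j"
      using that lt root_of_1_neq_0 [of r] by (simp add: pair_mat_def split: if_splits)
    then show ?thesis
      using root_of_1_power_eq_iff [OF assms(1)] by (simp add: cong_sym)
  qed
  then have "[(\<Sum>i<n. x' i) = (\<Sum>i<n. x i)] (mod r)"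
    by (intro cong_sum) auto
  then show "d = (\<Sum>i<n. x i) mod r"
    by (simp add: d cong_def)
qed

end

theory Submission
  imports Defs
begin

text \<open>For \<open>n \<ge> 3\<close> two orders recover the parameters: the centre of \<open>G(r,p,q,n)\<close> consists of
  the scalars and has order \<open>r gcd(p,n) / (pq)\<close>, and the derived subgroup has order
  \<open>|A\<^sub>n| r\<^sup>n / (r gcd(q,n))\<close>.  For \<open>n = 2\<close> there are further central classes
  when \<open>q\<close> is even; the order of the centre then separates the case where \<open>p\<close> and \<open>q\<close> are both
  even from the others, and the number of central involutions separates \<open>(p, q)\<close> odd/even from
  even/odd unless \<open>r / (pq)\<close> is odd.

  Isomorphisms are induced by maps \<open>(\<pi>, x) \<mapsto> (\<pi>, \<alpha> x + (J / p) \<Delta>(x))\<close> with integers \<open>\<alpha>\<close>, \<open>J\<close>.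
  If the gcd conditions hold, \<open>\<alpha> = 1\<close> suffices for moving a factor \<open>d\<close> from \<open>p\<close> to \<open>q\<close>, and
  two such moves connect \<open>(p, q)\<close> and \<open>(p', q')\<close> through \<open>(gcd(p,p'), lcm(q,q'))\<close>.
  In the exceptional case \<open>n = 2\<close> one takes \<open>x \<mapsto> (x\<^sub>1 - x\<^sub>2, x\<^sub>2 - x\<^sub>1)\<close> on the
  2-primary part and the identity on the odd part: both groups are dihedral 2-adically.\<close>

section \<open>Monomial matrices with integer exponents\<close>

text \<open>Elements of the quotient are cosets, so two of them are equal, or commute, when the
  exponent vectors involved agree up to one common shift by a multiple of \<open>r div q\<close>.
  This shift is the obstacle throughout. For \<open>n \<ge> 3\<close> a transposition leaves a third
  coordinate alone, and the congruence read there shows that the shift vanishes. For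
  \<open>n = 2\<close> no such coordinate exists, and for even \<open>q\<close> the shift by
  \<open>r / 2\<close> survives because the scalar -1 lies in \<open>C_q\<close>. Orders are found
  by counting matrices: the union of a set of cosets is \<open>q\<close> times as large, and in each
  case a divisibility condition on exponents describes it. The term with \<open>J\<close> is
  available because \<Delta>(x) / p is additive. It is determined only modulo \<open>r / p\<close>,
  and \<open>J\<close> must turn this ambiguity into an element of the target group
  \<open>C_q\<close>. When a factor \<open>d\<close> is moved, the map acts on the scalars of
  \<open>C_q\<close> through multiplication by a number \<open>u\<close>, and injectivity follows
  from \<open>u\<close> being coprime to \<open>r\<close>. The gcd conditions make such a
  \<open>J\<close> possible: they force the part of \<open>n\<close> built from primes of
  \<open>d\<close> to divide both \<open>p\<close> and \<open>q\<close>. Surjectivity follows from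
  equal orders.\<close>

definition zeta :: "nat \<Rightarrow> int \<Rightarrow> complex" where
  "zeta r a = root_of_1 r ^ nat (a mod int r)"

text \<open>Integer exponents allow inverses, differences and Bezout coefficients without
  truncation; only their residues modulo \<open>r\<close> matter.\<close>

definition monomial :: "nat \<Rightarrow> nat \<Rightarrow> (nat \<Rightarrow> nat) \<Rightarrow> (nat \<Rightarrow> int) \<Rightarrow> complex mat" where
  "monomial r n \<pi> x = mat n n (\<lambda>(i, j). if i = \<pi> j then zeta r (x j) else 0)"

lemma zeta_neq_0 [simp]: "zeta r a \<noteq> 0"
  by (simp add: zeta_def root_of_1_neq_0)

lemma zeta_eq_iff:
  assumes "r > 0"
  shows "zeta r a = zeta r b \<longleftrightarrow> [a = b] (mod int r)"
  using assms by (simp add: zeta_def root_of_1_power_eq_iff flip: cong_int_iff)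

lemma zeta_of_nat:
  assumes "r > 0"
  shows "zeta r (int a) = root_of_1 r ^ a"
  using assms by (simp add: zeta_def root_of_1_power_eq_iff flip: cong_int_iff)

lemma zeta_0 [simp]: "zeta r 0 = 1"
  by (simp add: zeta_def)

lemma zeta_add:
  assumes "r > 0"
  shows "zeta r (a + b) = zeta r a * zeta r b"
proof -
  have "zeta r a * zeta r b = root_of_1 r ^ (nat (a mod int r) + nat (b mod int r))"
    by (simp add: zeta_def power_add)
  also have "\<dots> = zeta r (a + b)"
    using assms
    by (simp add: zeta_def root_of_1_power_eq_iff flip: cong_int_iff) (simp add: cong_def mod_simps)
  finally show ?thesis ..
qed

lemma zeta_power:
  assumes "r > 0"
  shows "zeta r a ^ k = zeta r (a * int k)"
  using assms by (induction k) (auto simp: zeta_add algebra_simps)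

lemma root_of_unity_zeta:
  assumes "r > 0" "z ^ r = 1"
  obtains a where "z = zeta r a"
proof -
  have "z \<in> {exp (2 * of_real pi * \<i> * of_nat j / of_nat r) | j. j < r}"
    using complex_roots_unity [of r] assms by auto
  then obtain j where "z = exp (2 * of_real pi * \<i> * of_nat j / of_nat r)" by blast
  also have "\<dots> = root_of_1 r ^ j"
    by (simp add: root_of_1_def flip: exp_of_nat_mult) (simp add: mult_ac)
  finally show thesis using that zeta_of_nat [OF assms(1)] by metis
qed

lemma zeta_power_r:
  assumes "r > 0"
  shows "zeta r a ^ r = 1"
proof -
  have "zeta r a ^ r = zeta r 0"
    unfolding zeta_power [OF assms] zeta_eq_iff [OF assms] by (simp add: cong_def)
  then show ?thesis by simp
qed

lemma monomial_carrier [simp]: "monomial r n \<pi> x \<in> carrier_mat n n"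
  by (simp add: monomial_def)

lemma monomial_index:
  "i < n \<Longrightarrow> j < n \<Longrightarrow> monomial r n \<pi> x $$ (i, j) = (if i = \<pi> j then zeta r (x j) else 0)"
  by (simp add: monomial_def)

lemma monomial_eq_pair_mat: "monomial r n \<pi> x = pair_mat r n \<pi> (\<lambda>j. nat (x j mod int r))"
  unfolding monomial_def pair_mat_def zeta_def ..

lemma permutes_lessThan_lt: "\<pi> permutes {..<n} \<Longrightarrow> j < n \<Longrightarrow> \<pi> j < (n :: nat)"
  using permutes_in_image by fastforce

lemma monomial_eq_iff:
  assumes "r > 0" "\<pi> permutes {..<n}" "\<sigma> permutes {..<n}"
  shows "monomial r n \<pi> x = monomial r n \<sigma> y \<longleftrightarrow> \<pi> = \<sigma> \<and> (\<forall>j<n. [x j = y j] (mod int r))"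
proof
  assume eq: "monomial r n \<pi> x = monomial r n \<sigma> y"
  have *: "\<pi> j = \<sigma> j \<and> [x j = y j] (mod int r)" if "j < n" for j
  proof -
    have lt: "\<pi> j < n" using assms(2) that by (rule permutes_lessThan_lt)
    have "monomial r n \<sigma> y $$ (\<pi> j, j) = zeta r (x j)"
      unfolding eq [symmetric] using that lt by (simp add: monomial_index)
    then show ?thesis
      using that lt zeta_eq_iff [OF assms(1)] by (auto simp: monomial_index cong_sym_eq split: if_splits)
  qed
  moreover have "\<pi> = \<sigma>"
  proof
    fix j show "\<pi> j = \<sigma> j"
      using * assms(2,3) by (cases "j < n") (auto simp: permutes_def)
  qed
  ultimately show "\<pi> = \<sigma> \<and> (\<forall>j<n. [x j = y j] (mod int r))" by blast
next
  assume "\<pi> = \<sigma> \<and> (\<forall>j<n. [x j = y j] (mod int r))"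
  then show "monomial r n \<pi> x = monomial r n \<sigma> y"
    using zeta_eq_iff [OF assms(1)] by (auto simp: monomial_def intro!: cong_mat)
qed

lemma monomial_mult:
  assumes "r > 0" "\<sigma> permutes {..<n}"
  shows "monomial r n \<pi> x * monomial r n \<sigma> y = monomial r n (\<pi> \<circ> \<sigma>) (\<lambda>j. x (\<sigma> j) + y j)"
proof (rule eq_matI)
  fix i j
  assume "i < dim_row (monomial r n (\<pi> \<circ> \<sigma>) (\<lambda>j. x (\<sigma> j) + y j))"
    and "j < dim_col (monomial r n (\<pi> \<circ> \<sigma>) (\<lambda>j. x (\<sigma> j) + y j))"
  then have ij: "i < n" "j < n" by (simp_all add: monomial_def)
  have "(monomial r n \<pi> x * monomial r n \<sigma> y) $$ (i, j)
      = (\<Sum>k\<in>{0..<n}. monomial r n \<pi> x $$ (i, k) * monomial r n \<sigma> y $$ (k, j))"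
    using ij by (simp add: monomial_def scalar_prod_def)
  also have "\<dots> = (\<Sum>k\<in>{0..<n}. if k = \<sigma> j then monomial r n \<pi> x $$ (i, \<sigma> j) * zeta r (y j) else 0)"
    using ij by (intro sum.cong) (auto simp: monomial_index)
  also have "\<dots> = monomial r n \<pi> x $$ (i, \<sigma> j) * zeta r (y j)"
    using permutes_lessThan_lt [OF assms(2) ij(2)] by simp
  also have "\<dots> = monomial r n (\<pi> \<circ> \<sigma>) (\<lambda>j. x (\<sigma> j) + y j) $$ (i, j)"
    using ij permutes_lessThan_lt [OF assms(2) ij(2)]
    by (simp add: monomial_index zeta_add [OF assms(1)])
  finally show "(monomial r n \<pi> x * monomial r n \<sigma> y) $$ (i, j)
      = monomial r n (\<pi> \<circ> \<sigma>) (\<lambda>j. x (\<sigma> j) + y j) $$ (i, j)" .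
qed (simp_all add: monomial_def)

lemma monomial_one: "monomial r n id (\<lambda>_. 0) = 1\<^sub>m n"
  by (rule eq_matI) (auto simp: monomial_index, auto simp: monomial_def)

text \<open>Uniqueness in columns makes the support a function from columns to rows, uniqueness in
  rows makes it injective, and finiteness makes it bijective. Outside the index range it is the
  identity, as \<open>permutes\<close> demands.\<close>

lemma permutes_of_unique_rows:
  assumes "\<And>i. i < n \<Longrightarrow> \<exists>!j. j < n \<and> P i j" and "\<And>j. j < (n :: nat) \<Longrightarrow> \<exists>!i. i < n \<and> P i j"
  obtains \<pi> where "\<pi> permutes {..<n}" "\<And>i j. i < n \<Longrightarrow> j < n \<Longrightarrow> P i j \<longleftrightarrow> i = \<pi> j"
proof -
  define \<pi> where "\<pi> j = (if j < n then THE i. i < n \<and> P i j else j)" for j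
  have \<pi>: "\<pi> j < n \<and> P (\<pi> j) j" if "j < n" for j
    using theI' [OF assms(2) [OF that]] that by (simp add: \<pi>_def)
  have P_iff: "P i j \<longleftrightarrow> i = \<pi> j" if "i < n" "j < n" for i j
    using \<pi> that assms(2) by blast
  have "inj_on \<pi> {..<n}"
    using assms(1) \<pi> by (intro inj_onI) (metis lessThan_iff)
  moreover have "\<pi> ` {..<n} \<subseteq> {..<n}" using \<pi> by auto
  ultimately have "bij_betw \<pi> {..<n} {..<n}"
    by (simp add: bij_betw_def endo_inj_surj)
  then have "\<pi> permutes {..<n}"
    by (rule bij_imp_permutes) (simp add: \<pi>_def)
  then show thesis using that P_iff by blast
qed

lemma carrier_G_rn:
  assumes "r > 0"
  shows "carrier (G_rn r n) = {monomial r n \<pi> x | \<pi> x. \<pi> permutes {..<n}}"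
proof (intro equalityI subsetI)
  fix A assume "A \<in> carrier (G_rn r n)"
  then have A: "A \<in> carrier_mat n n"
    and row: "\<And>i. i < n \<Longrightarrow> \<exists>!j. j < n \<and> A $$ (i, j) \<noteq> 0"
    and col: "\<And>j. j < n \<Longrightarrow> \<exists>!i. i < n \<and> A $$ (i, j) \<noteq> 0"
    and pow: "\<And>i j. i < n \<Longrightarrow> j < n \<Longrightarrow> A $$ (i, j) \<noteq> 0 \<Longrightarrow> A $$ (i, j) ^ r = 1"
    by (auto simp: G_rn_def)
  obtain \<pi> where \<pi>: "\<pi> permutes {..<n}"
    and nz: "\<And>i j. i < n \<Longrightarrow> j < n \<Longrightarrow> A $$ (i, j) \<noteq> 0 \<longleftrightarrow> i = \<pi> j"
    using permutes_of_unique_rows [OF row col] by metis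
  have "\<exists>a. A $$ (\<pi> j, j) = zeta r a" if "j < n" for j
    using permutes_lessThan_lt [OF \<pi> that] that pow nz root_of_unity_zeta [OF assms] by metis
  then obtain x where x: "\<And>j. j < n \<Longrightarrow> A $$ (\<pi> j, j) = zeta r (x j)" by metis
  have "A = monomial r n \<pi> x"
    using A x nz by (intro eq_matI) (auto simp: monomial_index, auto simp: monomial_def)
  with \<pi> show "A \<in> {monomial r n \<pi> x | \<pi> x. \<pi> permutes {..<n}}" by blast
next
  fix A assume "A \<in> {monomial r n \<pi> x | \<pi> x. \<pi> permutes {..<n}}"
  then obtain \<pi> x where A: "A = monomial r n \<pi> x" and \<pi>: "\<pi> permutes {..<n}" by blast
  have "\<exists>!j. j < n \<and> A $$ (i, j) \<noteq> 0" if "i < n" for i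
  proof (rule ex1I [of _ "Hilbert_Choice.inv \<pi> i"])
    show "Hilbert_Choice.inv \<pi> i < n \<and> A $$ (i, Hilbert_Choice.inv \<pi> i) \<noteq> 0"
      using that permutes_lessThan_lt [OF permutes_inv [OF \<pi>] that] permutes_inverses(1) [OF \<pi>]
      by (simp add: A monomial_index)
    show "j = Hilbert_Choice.inv \<pi> i" if "j < n \<and> A $$ (i, j) \<noteq> 0" for j
      using that \<open>i < n\<close> permutes_inverses(2) [OF \<pi>]
      by (auto simp: A monomial_index split: if_splits)
  qed
  moreover have "\<exists>!i. i < n \<and> A $$ (i, j) \<noteq> 0" if "j < n" for j
    using that permutes_lessThan_lt [OF \<pi> that]
    by (intro ex1I [of _ "\<pi> j"]) (auto simp: A monomial_index split: if_splits)
  ultimately show "A \<in> carrier (G_rn r n)"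
    using zeta_power_r [OF assms] by (auto simp: G_rn_def A monomial_index)
qed

section \<open>Group structure of \<open>G_rn\<close> and \<open>G_rpn\<close>\<close>

lemma mult_G_rn [simp]: "monoid.mult (G_rn r n) = (*)"
  by (simp add: G_rn_def)

lemma one_G_rn [simp]: "monoid.one (G_rn r n) = 1\<^sub>m n"
  by (simp add: G_rn_def)

lemma monomial_in_G_rn:
  "r > 0 \<Longrightarrow> \<pi> permutes {..<n} \<Longrightarrow> monomial r n \<pi> x \<in> carrier (G_rn r n)"
  by (auto simp: carrier_G_rn)

lemma monomial_inverse:
  assumes "r > 0" "\<pi> permutes {..<n}"
  shows "monomial r n (Hilbert_Choice.inv \<pi>) (\<lambda>j. - x (Hilbert_Choice.inv \<pi> j)) * monomial r n \<pi> x
    = 1\<^sub>m n"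
  using assms permutes_inv_o(2) [OF assms(2)] permutes_inverses(2) [OF assms(2)]
  by (simp add: monomial_mult monomial_one flip: id_def)

lemma group_G_rn:
  assumes "r > 0"
  shows "group (G_rn r n)"
proof (rule groupI)
  fix A B C
  assume "A \<in> carrier (G_rn r n)" "B \<in> carrier (G_rn r n)" "C \<in> carrier (G_rn r n)"
  then have "A \<in> carrier_mat n n" "B \<in> carrier_mat n n" "C \<in> carrier_mat n n"
    by (auto simp: G_rn_def)
  then show "A \<otimes>\<^bsub>G_rn r n\<^esub> B \<otimes>\<^bsub>G_rn r n\<^esub> C = A \<otimes>\<^bsub>G_rn r n\<^esub> (B \<otimes>\<^bsub>G_rn r n\<^esub> C)"
    by simp
next
  fix A B assume "A \<in> carrier (G_rn r n)" "B \<in> carrier (G_rn r n)"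
  then show "A \<otimes>\<^bsub>G_rn r n\<^esub> B \<in> carrier (G_rn r n)"
    using assms permutes_compose by (fastforce simp: carrier_G_rn monomial_mult)
next
  show "\<one>\<^bsub>G_rn r n\<^esub> \<in> carrier (G_rn r n)"
    using monomial_in_G_rn [OF assms permutes_id, of n "\<lambda>_. 0"] by (simp add: monomial_one)
next
  fix A assume "A \<in> carrier (G_rn r n)"
  then show "\<one>\<^bsub>G_rn r n\<^esub> \<otimes>\<^bsub>G_rn r n\<^esub> A = A" by (auto simp: G_rn_def)
  show "\<exists>B\<in>carrier (G_rn r n). B \<otimes>\<^bsub>G_rn r n\<^esub> A = \<one>\<^bsub>G_rn r n\<^esub>"
    using \<open>A \<in> carrier (G_rn r n)\<close> monomial_inverse [OF assms] permutes_inv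
    by (fastforce simp: carrier_G_rn [OF assms])
qed

lemma Delta_monomial:
  assumes "r > 0" "\<pi> permutes {..<n}"
  shows "int (Delta r n (monomial r n \<pi> x)) = (\<Sum>i<n. x i) mod int r"
  using assms by (simp add: monomial_eq_pair_mat Delta_pair_mat zmod_int mod_sum_eq)

lemma multiples_mod_iff:
  assumes "r > 0" "p dvd r"
  shows "d \<in> multiples_mod p r \<longleftrightarrow> d < r \<and> p dvd d"
proof
  assume "d \<in> multiples_mod p r"
  then show "d < r \<and> p dvd d" using assms by (auto simp: multiples_mod_def dvd_mod)
next
  assume "d < r \<and> p dvd d"
  then show "d \<in> multiples_mod p r" by (auto simp: multiples_mod_def elim!: dvdE)
      (metis mod_less)
qed

text \<open>As \<open>p\<close> divides \<open>r\<close>, reduction modulo \<open>r\<close> does not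
  affect divisibility by \<open>p\<close>, so membership can be read off from the integer
  sum.\<close>

lemma monomial_in_G_rpn_iff:
  assumes "r > 0" "p dvd r" "\<pi> permutes {..<n}"
  shows "monomial r n \<pi> x \<in> carrier (G_rpn r p n) \<longleftrightarrow> int p dvd (\<Sum>i<n. x i)"
proof -
  have "Delta r n (monomial r n \<pi> x) < r"
    using Delta_monomial [OF assms(1,3), of x] assms(1)
    by (metis of_nat_0_less_iff of_nat_less_iff pos_mod_bound)
  moreover have "p dvd Delta r n (monomial r n \<pi> x) \<longleftrightarrow> int p dvd (\<Sum>i<n. x i)"
    using assms(2) by (simp add: Delta_monomial [OF assms(1,3)] dvd_mod_iff flip: int_dvd_int_iff)
  ultimately show ?thesis
    using assms by (simp add: G_rpn_def monomial_in_G_rn multiples_mod_iff)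
qed

lemma carrier_G_rpn:
  assumes "r > 0" "p dvd r"
  shows "carrier (G_rpn r p n) =
    {monomial r n \<pi> x | \<pi> x. \<pi> permutes {..<n} \<and> int p dvd (\<Sum>i<n. x i)}"
proof -
  have "carrier (G_rpn r p n) \<subseteq> carrier (G_rn r n)" by (auto simp: G_rpn_def)
  then show ?thesis
    using monomial_in_G_rpn_iff [OF assms] unfolding carrier_G_rn [OF assms(1)] by blast
qed

lemma mult_G_rpn [simp]: "monoid.mult (G_rpn r p n) = (*)"
  by (simp add: G_rpn_def)

lemma one_G_rpn [simp]: "monoid.one (G_rpn r p n) = 1\<^sub>m n"
  by (simp add: G_rpn_def)

lemma sum_permutes:
  assumes "\<pi> permutes {..<n}"
  shows "(\<Sum>i<n. x (\<pi> i)) = (\<Sum>i<(n :: nat). x i :: int)"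
  by (rule sum.permute [OF assms, symmetric, unfolded comp_def])

section \<open>The symmetric group and subgroups of monomial matrices\<close>

definition perm_group :: "nat \<Rightarrow> (nat \<Rightarrow> nat) monoid" where
  "perm_group n = \<lparr>carrier = {\<pi>. \<pi> permutes {..<n}}, monoid.mult = (\<circ>), one = id\<rparr>"

lemma perm_group_simps [simp]:
  "carrier (perm_group n) = {\<pi>. \<pi> permutes {..<n}}"
  "monoid.mult (perm_group n) = (\<circ>)"
  "\<one>\<^bsub>perm_group n\<^esub> = id"
  by (simp_all add: perm_group_def)

lemma group_perm_group: "group (perm_group n)"
proof (rule groupI)
  fix \<pi> assume "\<pi> \<in> carrier (perm_group n)"
  then show "\<exists>\<sigma>\<in>carrier (perm_group n). \<sigma> \<otimes>\<^bsub>perm_group n\<^esub> \<pi> = \<one>\<^bsub>perm_group n\<^esub>"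
    using permutes_inv permutes_inv_o(2) by (intro bexI [of _ "Hilbert_Choice.inv \<pi>"]) auto
qed (auto simp: permutes_compose permutes_id comp_assoc)

lemma inv_perm_group:
  assumes "\<pi> permutes {..<n}"
  shows "inv\<^bsub>perm_group n\<^esub> \<pi> = Hilbert_Choice.inv \<pi>"
  using assms permutes_inv [OF assms] permutes_inv_o(2) [OF assms]
  by (intro group.inv_equality [OF group_perm_group]) auto

lemma inv_monomial:
  assumes "r > 0" "\<pi> permutes {..<n}"
  shows "inv\<^bsub>G_rn r n\<^esub> (monomial r n \<pi> x)
    = monomial r n (Hilbert_Choice.inv \<pi>) (\<lambda>j. - x (Hilbert_Choice.inv \<pi> j))"
  using monomial_inverse [OF assms, of x] assms
  by (intro group.inv_equality [OF group_G_rn [OF assms(1)]])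
    (auto intro: monomial_in_G_rn permutes_inv)

text \<open>The exponent sum is additive under multiplication, since permuting coordinates does not
  change it. All permutations with \<open>m = p\<close> give G(r,p,n); the derived subgroup of the
  symmetric group with \<open>m = r\<close> gives the upper bound for the derived subgroup of
  G(r,p,n).\<close>

lemma subgroup_monomials:
  assumes r: "r > 0" and A: "subgroup A (perm_group n)"
  shows "subgroup {monomial r n \<pi> x | \<pi> x. \<pi> \<in> A \<and> int m dvd (\<Sum>i<n. x i)} (G_rn r n)" (is "subgroup ?S _")
proof (rule group.subgroupI [OF group_G_rn [OF r]])
  have perm: "\<pi> permutes {..<n}" if "\<pi> \<in> A" for \<pi>
    using subgroup.mem_carrier [OF A that] by simp
  show "?S \<subseteq> carrier (G_rn r n)"
    using monomial_in_G_rn [OF r perm] by auto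
  have "id \<in> A" using subgroup.one_closed [OF A] by simp
  then have "monomial r n id (\<lambda>_. 0) \<in> ?S" by force
  then show "?S \<noteq> {}" by blast
  show "inv\<^bsub>G_rn r n\<^esub> g \<in> ?S" if "g \<in> ?S" for g
  proof -
    from that obtain \<pi> x where g: "g = monomial r n \<pi> x" and \<pi>: "\<pi> \<in> A" and x: "int m dvd (\<Sum>i<n. x i)"
      by blast
    have "Hilbert_Choice.inv \<pi> \<in> A"
      using subgroup.m_inv_closed [OF A \<pi>] inv_perm_group [OF perm [OF \<pi>]] by simp
    moreover have "int m dvd (\<Sum>i<n. - x (Hilbert_Choice.inv \<pi> i))"
      using x sum_permutes [OF permutes_inv [OF perm [OF \<pi>]], of x] by (simp add: sum_negf)
    ultimately show ?thesis unfolding g inv_monomial [OF r perm [OF \<pi>]] by blast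
  qed
  show "g \<otimes>\<^bsub>G_rn r n\<^esub> h \<in> ?S" if "g \<in> ?S" "h \<in> ?S" for g h
  proof -
    from that obtain \<pi> x \<sigma> y where g: "g = monomial r n \<pi> x" "\<pi> \<in> A" "int m dvd (\<Sum>i<n. x i)"
      and h: "h = monomial r n \<sigma> y" "\<sigma> \<in> A" "int m dvd (\<Sum>i<n. y i)" by blast
    have "\<pi> \<circ> \<sigma> \<in> A" using subgroup.m_closed [OF A g(2) h(2)] by simp
    moreover have "int m dvd (\<Sum>i<n. x (\<sigma> i) + y i)"
      using g h sum_permutes [OF perm [OF h(2)], of x] by (simp add: sum.distrib)
    ultimately show ?thesis
      unfolding g(1) h(1) mult_G_rn monomial_mult [OF r perm [OF h(2)]] by blast
  qed
qed

lemma subgroup_G_rpn: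
  assumes "r > 0" "p dvd r"
  shows "subgroup (carrier (G_rpn r p n)) (G_rn r n)"
  using subgroup_monomials [OF assms(1) group.subgroup_self [OF group_perm_group], of n p]
  by (simp add: carrier_G_rpn [OF assms])

lemma group_G_rpn:
  assumes "r > 0" "p dvd r"
  shows "group (G_rpn r p n)"
proof -
  have "G_rpn r p n = (G_rn r n)\<lparr>carrier := carrier (G_rpn r p n)\<rparr>"
    by (simp add: G_rpn_def)
  then show ?thesis
    using subgroup.subgroup_is_group [OF subgroup_G_rpn [OF assms] group_G_rn [OF assms(1)]]
    by metis
qed

section \<open>Scalar matrices and the subgroup \<open>C_q\<close>\<close>

abbreviation scalar :: "nat \<Rightarrow> nat \<Rightarrow> int \<Rightarrow> complex mat" where
  "scalar r n a \<equiv> monomial r n id (\<lambda>_. a)"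

lemma central_elt_eq: "r > 0 \<Longrightarrow> central_elt r n = scalar r n 1"
  using zeta_of_nat [of r 1]
  by (auto simp: central_elt_def monomial_def intro!: eq_matI)

lemma scalar_pow:
  fixes a :: int and k :: nat
  assumes "r > 0"
  shows "scalar r n a [^]\<^bsub>G_rn r n\<^esub> k = scalar r n (int k * a)"
proof (rule nat_induct [of _ k])
  show "scalar r n a [^]\<^bsub>G_rn r n\<^esub> (0 :: nat) = scalar r n (int 0 * a)"
    by (simp add: monomial_one)
next
  fix k assume "scalar r n a [^]\<^bsub>G_rn r n\<^esub> k = scalar r n (int k * a)"
  then show "scalar r n a [^]\<^bsub>G_rn r n\<^esub> Suc k = scalar r n (int (Suc k) * a)"
    using assms by (simp add: monomial_mult permutes_id algebra_simps)
qed

lemma scalar_inv: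
  fixes a :: int
  assumes "r > 0"
  shows "inv\<^bsub>G_rn r n\<^esub> (scalar r n a) = monomial r n id (\<lambda>_. - a)"
  using assms
  by (intro group.inv_equality [OF group_G_rn])
    (auto simp: monomial_in_G_rn permutes_id monomial_mult monomial_one)

lemma C_q_eq:
  assumes "r > 0"
  shows "C_q r q n = {scalar r n (int (r div q) * t) | t. True}"
proof -
  interpret group "G_rn r n" by (rule group_G_rn [OF assms])
  have c: "central_elt r n [^]\<^bsub>G_rn r n\<^esub> (r div q) = scalar r n (int (r div q))"
    using scalar_pow [OF assms, of n 1] by (simp add: central_elt_eq [OF assms])
  have "scalar r n (int (r div q)) [^]\<^bsub>G_rn r n\<^esub> (t :: int)
      = scalar r n (int (r div q) * t)" for t
    by (simp add: int_pow_def2 scalar_pow [OF assms] scalar_inv [OF assms] mult.commute)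
  then show ?thesis
    unfolding C_q_def c
    using generate_pow [OF monomial_in_G_rn [OF assms permutes_id], of "\<lambda>_. int (r div q)"]
    by auto
qed

section \<open>Counting\<close>

text \<open>The sum modulo \<open>m\<close> can be adjusted freely in coordinate 0, so all
  \<open>m\<close> residues occur equally often: a vector arises from exactly one vector with sum
  divisible by \<open>m\<close> by adding one \<open>c\<close> in \<open>{0..<m}\<close> at
  coordinate 0. The inverse subtracts the residue of the sum there.\<close>

lemma bij_betw_shift_PiE:
  fixes m r :: int and n :: nat
  assumes "m > 0" "m dvd r" "n > 0" "r > 0"
  shows "bij_betw (\<lambda>(x, c). x(0 := (x 0 + c) mod r))
    ({x \<in> {..<n} \<rightarrow>\<^sub>E {0..<r}. m dvd (\<Sum>i<n. x i)} \<times> {0..<m}) ({..<n} \<rightarrow>\<^sub>E {0..<r})"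
proof -
  let ?s = "\<lambda>x :: nat \<Rightarrow> int. \<Sum>i<n. x i"
  have sum_upd: "[?s (x(0 := a mod r)) = ?s x - x 0 + a] (mod m)" for x :: "nat \<Rightarrow> int" and a
  proof -
    have "?s y = y 0 + (\<Sum>i\<in>{..<n} - {0}. y i)" for y :: "nat \<Rightarrow> int"
      using assms(3) by (intro sum.remove) auto
    from this [of x] this [of "x(0 := a mod r)"]
    have "?s (x(0 := a mod r)) = ?s x - x 0 + a mod r" by simp
    moreover have "[a mod r = a] (mod m)" using assms(2) by (simp add: cong_def mod_mod_cancel)
    ultimately show ?thesis by (simp add: cong_add_lcancel)
  qed
  let ?f = "\<lambda>(x, c). x(0 := (x 0 + c) mod r)"
  let ?g = "\<lambda>x. (x(0 := (x 0 - ?s x mod m) mod r), ?s x mod m)"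
  show ?thesis
  proof (rule bij_betw_byWitness [of _ ?g])
    show "\<forall>a\<in>{x \<in> {..<n} \<rightarrow>\<^sub>E {0..<r}. m dvd ?s x} \<times> {0..<m}. ?g (?f a) = a"
    proof
      fix a assume "a \<in> {x \<in> {..<n} \<rightarrow>\<^sub>E {0..<r}. m dvd ?s x} \<times> {0..<m}"
      then obtain x c where a: "a = (x, c)" and x: "x \<in> {..<n} \<rightarrow>\<^sub>E {0..<r}" "m dvd ?s x"
        and c: "0 \<le> c" "c < m" by auto
      have "[?s x + c = 0 + c] (mod m)" using x(2) by (intro cong_add) (simp_all add: cong_0_iff)
      then have "?s (x(0 := (x 0 + c) mod r)) mod m = c"
        using sum_upd [of x "x 0 + c"] c by (simp add: cong_def)
      moreover have "((x 0 + c) mod r - c) mod r = x 0"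
        using PiE_mem [OF x(1), of 0] assms(3) by (simp add: mod_diff_left_eq)
      ultimately show "?g (?f a) = a" unfolding a by simp
    qed
    show "\<forall>x\<in>{..<n} \<rightarrow>\<^sub>E {0..<r}. ?f (?g x) = x"
    proof
      fix x assume "x \<in> {..<n} \<rightarrow>\<^sub>E {0..<r}"
      from PiE_mem [OF this, of 0] have "((x 0 - ?s x mod m) mod r + ?s x mod m) mod r = x 0"
        using assms(3) by (simp add: mod_add_left_eq)
      then show "?f (?g x) = x" by simp
    qed
    have upd: "x(0 := a mod r) \<in> {..<n} \<rightarrow>\<^sub>E {0..<r}" if "x \<in> {..<n} \<rightarrow>\<^sub>E {0..<r}" for x a
      using that assms(3,4) by (simp add: PiE_iff extensional_def)
    then show "?f ` ({x \<in> {..<n} \<rightarrow>\<^sub>E {0..<r}. m dvd ?s x} \<times> {0..<m}) \<subseteq> {..<n} \<rightarrow>\<^sub>E {0..<r}"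
      by (simp add: image_subset_iff)
    show "?g ` ({..<n} \<rightarrow>\<^sub>E {0..<r}) \<subseteq> {x \<in> {..<n} \<rightarrow>\<^sub>E {0..<r}. m dvd ?s x} \<times> {0..<m}"
    proof (rule image_subsetI)
      fix x assume x: "x \<in> {..<n} \<rightarrow>\<^sub>E {0..<r}"
      have "[?s x - x 0 + (x 0 - ?s x mod m) = 0] (mod m)"
        by (simp add: cong_def mod_diff_right_eq)
      then have "m dvd ?s (x(0 := (x 0 - ?s x mod m) mod r))"
        using sum_upd [of x "x 0 - ?s x mod m"] by (meson cong_0_iff cong_trans)
      then show "?g x \<in> {x \<in> {..<n} \<rightarrow>\<^sub>E {0..<r}. m dvd ?s x} \<times> {0..<m}"
        using upd [OF x] assms(1) by (simp del: fun_upd_apply)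
    qed
  qed
qed

lemma card_PiE_sum_dvd:
  fixes m r n :: nat
  assumes "m dvd r" "n > 0" "r > 0"
  shows "m * card {x \<in> {..<n} \<rightarrow>\<^sub>E {0..<int r}. int m dvd (\<Sum>i<n. x i)} = r ^ n"
proof -
  have "m > 0" using assms by (auto intro: Nat.gr0I)
  then have "card ({x \<in> {..<n} \<rightarrow>\<^sub>E {0..<int r}. int m dvd (\<Sum>i<n. x i)} \<times> {0..<int m})
      = card ({..<n} \<rightarrow>\<^sub>E {0..<int r})"
    using bij_betw_same_card [OF bij_betw_shift_PiE [of "int m" "int r" n]] assms by simp
  then show ?thesis by (simp add: card_cartesian_product card_PiE mult.commute)
qed

lemma monomial_mod:
  "r > 0 \<Longrightarrow> \<pi> permutes {..<n} \<Longrightarrow>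
    monomial r n \<pi> (restrict (\<lambda>j. x j mod int r) {..<n}) = monomial r n \<pi> x"
  by (simp add: monomial_eq_iff cong_def)

text \<open>Exponent vectors with entries in \<open>{0..<r}\<close> are unique representatives, and
  \<open>m dvd r\<close> makes the condition on the sum independent of the representative. The
  product form keeps the count free of division.\<close>

lemma card_monomials:
  assumes "r > 0" "n > 0" "m dvd r" "A \<subseteq> {\<pi>. \<pi> permutes {..<n}}"
  shows "m * card {monomial r n \<pi> x | \<pi> x. \<pi> \<in> A \<and> int m dvd (\<Sum>i<n. x i)} = card A * r ^ n"
    (is "m * card ?M = _")
proof -
  let ?X = "{x \<in> {..<n} \<rightarrow>\<^sub>E {0..<int r}. int m dvd (\<Sum>i<n. x i)}"
  have "bij_betw (\<lambda>(\<pi>, x). monomial r n \<pi> x) (A \<times> ?X) ?M"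
    unfolding bij_betw_def
  proof
    show "inj_on (\<lambda>(\<pi>, x). monomial r n \<pi> x) (A \<times> ?X)"
    proof (rule inj_onI, clarify)
      fix \<pi> x \<sigma> y assume *: "monomial r n \<pi> x = monomial r n \<sigma> y" "\<pi> \<in> A" "\<sigma> \<in> A"
        and x: "x \<in> {..<n} \<rightarrow>\<^sub>E {0..<int r}" and y: "y \<in> {..<n} \<rightarrow>\<^sub>E {0..<int r}"
      from *(2,3) assms(4) have "\<pi> permutes {..<n}" "\<sigma> permutes {..<n}" by auto
      with *(1) have "\<pi> = \<sigma>" and cong: "\<forall>j<n. [x j = y j] (mod int r)"
        using assms(1) by (simp_all add: monomial_eq_iff)
      have "x j = y j" if "j < n" for j
      proof (rule cong_less_imp_eq_int)
        have "x j \<in> {0..<int r}" "y j \<in> {0..<int r}" using x y that by (auto simp: PiE_iff)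
        then show "0 \<le> x j" "x j < int r" "0 \<le> y j" "y j < int r" by auto
        show "[x j = y j] (mod int r)" using cong that by blast
      qed
      then have "x = y" using x y by (intro PiE_ext) auto
      with \<open>\<pi> = \<sigma>\<close> show "\<pi> = \<sigma> \<and> x = y" by blast
    qed
    show "(\<lambda>(\<pi>, x). monomial r n \<pi> x) ` (A \<times> ?X) = ?M"
    proof (intro equalityI subsetI)
      fix g assume "g \<in> ?M"
      then obtain \<pi> x where g: "g = monomial r n \<pi> x" "\<pi> \<in> A" "int m dvd (\<Sum>i<n. x i)" by blast
      let ?x = "restrict (\<lambda>j. x j mod int r) {..<n}"
      have "(\<Sum>i<n. ?x i) mod int m = (\<Sum>i<n. x i mod int r mod int m) mod int m"
        by (simp add: mod_sum_eq)
      also have "\<dots> = (\<Sum>i<n. x i) mod int m"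
        using assms(3) by (simp add: mod_mod_cancel mod_sum_eq)
      finally have "int m dvd (\<Sum>i<n. ?x i)" using g(3) by (metis dvd_eq_mod_eq_0)
      moreover have "g = monomial r n \<pi> ?x" using assms g by (subst monomial_mod) auto
      moreover have "?x \<in> {..<n} \<rightarrow>\<^sub>E {0..<int r}" using assms(1) by auto
      ultimately show "g \<in> (\<lambda>(\<pi>, x). monomial r n \<pi> x) ` (A \<times> ?X)" using g(2) by blast
    next
      fix g assume "g \<in> (\<lambda>(\<pi>, x). monomial r n \<pi> x) ` (A \<times> ?X)"
      then show "g \<in> ?M" by auto
    qed
  qed
  from bij_betw_same_card [OF this] have "card ?M = card A * card ?X"
    by (simp add: card_cartesian_product)
  then show ?thesis using card_PiE_sum_dvd [OF assms(3,2,1)] by (simp add: mult.left_commute)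
qed

lemma card_scalars:
  assumes "r > 0" "n > 0" "m dvd r"
  shows "m * card {scalar r n a | a. int m dvd a} = r"
proof -
  have "m > 0" using assms by (auto intro: Nat.gr0I)
  obtain k where k: "r = m * k" using assms(3) by blast
  have "bij_betw (\<lambda>i. scalar r n (int m * int i)) {..<k} {scalar r n a | a. int m dvd a}"
    unfolding bij_betw_def
  proof
    show "inj_on (\<lambda>i. scalar r n (int m * int i)) {..<k}"
    proof (rule inj_onI)
      fix i j assume ij: "i \<in> {..<k}" "j \<in> {..<k}"
        and "scalar r n (int m * int i) = scalar r n (int m * int j)"
      then have "[m * i = m * j] (mod r)"
        using assms by (auto simp: monomial_eq_iff permutes_id simp flip: cong_int_iff)
      moreover have "m * i < r" "m * j < r" using ij \<open>m > 0\<close> by (auto simp: k)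
      ultimately show "i = j" using \<open>m > 0\<close> by (simp add: cong_def)
    qed
    show "(\<lambda>i. scalar r n (int m * int i)) ` {..<k} = {scalar r n a | a. int m dvd a}"
    proof (intro equalityI subsetI)
      fix g assume "g \<in> {scalar r n a | a. int m dvd a}"
      then obtain b where b: "g = scalar r n (int m * b)" by (auto elim!: dvdE)
      have "k > 0" using assms(1) by (simp add: k)
      have "[int m * b = int m * (b mod int k)] (mod int r)"
        by (simp add: k cong_def mod_simps flip: mult_mod_right)
      then have "g = scalar r n (int m * int (nat (b mod int k)))"
        using assms \<open>k > 0\<close> by (simp add: b monomial_eq_iff permutes_id)
      moreover have "nat (b mod int k) \<in> {..<k}"
        using \<open>k > 0\<close> by (simp add: nat_less_iff)
      ultimately show "g \<in> (\<lambda>i. scalar r n (int m * int i)) ` {..<k}" by blast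
    qed auto
  qed
  from bij_betw_same_card [OF this] show ?thesis by (simp add: k)
qed

section \<open>The quotient groups\<close>

text \<open>The coset of \<open>C_q r q n\<close> through a monomial matrix. It does not mention
  \<open>p\<close>, so the same classes serve all groups with the same \<open>q\<close>.\<close>

definition cls :: "nat \<Rightarrow> nat \<Rightarrow> nat \<Rightarrow> (nat \<Rightarrow> nat) \<Rightarrow> (nat \<Rightarrow> int) \<Rightarrow> complex mat set" where
  "cls r q n \<pi> x = {monomial r n \<pi> (\<lambda>j. x j + int (r div q) * t) | t. True}"

lemma r_coset_C_q:
  assumes "r > 0" "\<pi> permutes {..<n}"
  shows "C_q r q n #>\<^bsub>G_rpn r p n\<^esub> monomial r n \<pi> x = cls r q n \<pi> x"
proof -
  have "scalar r n a * monomial r n \<pi> x = monomial r n \<pi> (\<lambda>j. x j + a)" for a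
    using monomial_mult [OF assms, of id "\<lambda>_. a" x] by (simp add: add.commute)
  then show ?thesis by (auto simp: r_coset_def C_q_eq [OF assms(1)] cls_def)
qed

lemma cls_eq_iff:
  assumes "r > 0" "\<pi> permutes {..<n}" "\<sigma> permutes {..<n}"
  shows "cls r q n \<pi> x = cls r q n \<sigma> y \<longleftrightarrow>
    \<pi> = \<sigma> \<and> (\<exists>t. \<forall>j<n. [x j = y j + int (r div q) * t] (mod int r))"
proof
  assume eq: "cls r q n \<pi> x = cls r q n \<sigma> y"
  have "monomial r n \<pi> (\<lambda>j. x j + int (r div q) * 0) \<in> cls r q n \<pi> x"
    unfolding cls_def by blast
  then obtain t where "monomial r n \<pi> x = monomial r n \<sigma> (\<lambda>j. y j + int (r div q) * t)"
    unfolding eq by (auto simp: cls_def)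
  then show "\<pi> = \<sigma> \<and> (\<exists>t. \<forall>j<n. [x j = y j + int (r div q) * t] (mod int r))"
    unfolding monomial_eq_iff [OF assms] by blast
next
  assume "\<pi> = \<sigma> \<and> (\<exists>t. \<forall>j<n. [x j = y j + int (r div q) * t] (mod int r))"
  then obtain t where "\<pi> = \<sigma>" and t: "\<And>j. j < n \<Longrightarrow> [x j = y j + int (r div q) * t] (mod int r)"
    by blast
  have "monomial r n \<sigma> (\<lambda>j. x j + int (r div q) * s)
      = monomial r n \<sigma> (\<lambda>j. y j + int (r div q) * (s + t))" for s
    using cong_add [OF t cong_refl, of _ "int (r div q) * s"]
    by (simp add: monomial_eq_iff [OF assms(1,3,3)] algebra_simps)
  moreover from this [of "s - t" for s]
  have "monomial r n \<sigma> (\<lambda>j. y j + int (r div q) * s)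
      = monomial r n \<sigma> (\<lambda>j. x j + int (r div q) * (s - t))" for s
    by simp
  ultimately show "cls r q n \<pi> x = cls r q n \<sigma> y"
    unfolding cls_def \<open>\<pi> = \<sigma>\<close> by blast
qed

locale projective_reflection_group =
  fixes r n p q :: nat
  assumes r_pos: "r > 0" and n_pos: "n > 0" and p_dvd: "p dvd r" and q_dvd: "q dvd r"
    and pq_dvd: "p * q dvd r * n"
begin

lemma p_pos: "p > 0" and q_pos: "q > 0"
  using p_dvd q_dvd r_pos by (auto intro: Nat.gr0I)

lemma r_div_q: "int (r div q) * int q = int r"
  using q_dvd by (metis dvd_div_mult_self of_nat_mult)

lemma r_div_q_dvd: "r div q dvd r"
  using q_dvd by (metis dvd_div_mult_self dvd_triv_left)

lemma r_div_q_pos: "r div q > 0"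
  using r_div_q_dvd r_pos by (rule dvd_pos_nat [rotated])

sublocale G: group "G_rpn r p n"
  by (rule group_G_rpn [OF r_pos p_dvd])

text \<open>Multiplication by \<open>c ^ (r div q)\<close> adds \<open>n * (r div q)\<close> to the
  exponent sum. That \<open>p * q\<close> divides \<open>r * n\<close> means precisely that this
  increment is a multiple of \<open>p\<close>, which places \<open>C_q\<close> inside
  G(r,p,n).\<close>

lemma p_dvd_n_r_div_q: "p dvd n * (r div q)"
proof -
  have "q * p dvd q * (n * (r div q))"
    using pq_dvd q_dvd by (simp add: ac_simps)
  then show ?thesis using q_pos by simp
qed

lemma C_q_subset: "C_q r q n \<subseteq> carrier (G_rpn r p n)"
proof
  fix g assume "g \<in> C_q r q n"
  then obtain t where g: "g = scalar r n (int (r div q) * t)"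
    by (auto simp: C_q_eq [OF r_pos])
  have "int p dvd int (n * (r div q)) * t"
    using p_dvd_n_r_div_q by (intro dvd_mult2) (simp only: int_dvd_int_iff)
  then show "g \<in> carrier (G_rpn r p n)"
    by (simp add: g monomial_in_G_rpn_iff [OF r_pos p_dvd permutes_id] mult.assoc)
qed

lemma normal_C_q: "C_q r q n \<lhd> G_rpn r p n"
proof (rule G.normalI)
  have "subgroup (C_q r q n) (G_rn r n)"
    unfolding C_q_def
    by (intro group.generate_is_subgroup [OF group_G_rn [OF r_pos]])
      (simp add: central_elt_eq [OF r_pos] scalar_pow [OF r_pos] monomial_in_G_rn [OF r_pos permutes_id])
  then have "subgroup (C_q r q n) ((G_rn r n)\<lparr>carrier := carrier (G_rpn r p n)\<rparr>)"
    using group.subgroup_incl [OF group_G_rn [OF r_pos] _ subgroup_G_rpn [OF r_pos p_dvd]] C_q_subset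
    by blast
  moreover have eq: "G_rpn r p n = (G_rn r n)\<lparr>carrier := carrier (G_rpn r p n)\<rparr>"
    by (simp add: G_rpn_def)
  ultimately show "subgroup (C_q r q n) (G_rpn r p n)"
    by (subst eq)
  have "scalar r n a * g = g * scalar r n a" if "g \<in> carrier (G_rpn r p n)" for a g
    using that by (auto simp: carrier_G_rpn [OF r_pos p_dvd] monomial_mult r_pos permutes_id add.commute)
  then show "\<forall>g\<in>carrier (G_rpn r p n). C_q r q n #>\<^bsub>G_rpn r p n\<^esub> g = g <#\<^bsub>G_rpn r p n\<^esub> C_q r q n"
    by (auto simp: r_coset_def l_coset_def C_q_eq [OF r_pos])
qed

sublocale N: normal "C_q r q n" "G_rpn r p n"
  by (rule normal_C_q)

lemma group_Q: "group (G_rpqn r p q n)"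
  unfolding G_rpqn_def by (rule N.factorgroup_is_group)

lemma carrier_Q:
  "carrier (G_rpqn r p q n) =
    {cls r q n \<pi> x | \<pi> x. \<pi> permutes {..<n} \<and> int p dvd (\<Sum>i<n. x i)}"
proof -
  have "carrier (G_rpqn r p q n)
      = {C_q r q n #>\<^bsub>G_rpn r p n\<^esub> monomial r n \<pi> x | \<pi> x. \<pi> permutes {..<n} \<and> int p dvd (\<Sum>i<n. x i)}"
    unfolding G_rpqn_def carrier_FactGroup carrier_G_rpn [OF r_pos p_dvd] by blast
  also have "\<dots> = {cls r q n \<pi> x | \<pi> x. \<pi> permutes {..<n} \<and> int p dvd (\<Sum>i<n. x i)}"
    by (intro Collect_cong iff_exI) (auto simp: r_coset_C_q [OF r_pos])
  finally show ?thesis .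
qed

lemma cls_in_Q:
  "\<pi> permutes {..<n} \<Longrightarrow> int p dvd (\<Sum>i<n. x i) \<Longrightarrow> cls r q n \<pi> x \<in> carrier (G_rpqn r p q n)"
  by (auto simp: carrier_Q)

lemma mult_Q:
  assumes "\<pi> permutes {..<n}" "\<sigma> permutes {..<n}"
    and "int p dvd (\<Sum>i<n. x i)" "int p dvd (\<Sum>i<n. y i)"
  shows "cls r q n \<pi> x \<otimes>\<^bsub>G_rpqn r p q n\<^esub> cls r q n \<sigma> y
    = cls r q n (\<pi> \<circ> \<sigma>) (\<lambda>j. x (\<sigma> j) + y j)"
proof -
  have "monomial r n \<pi> x \<in> carrier (G_rpn r p n)" "monomial r n \<sigma> y \<in> carrier (G_rpn r p n)"
    using assms by (auto simp: monomial_in_G_rpn_iff [OF r_pos p_dvd])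
  from N.rcos_sum [OF this] show ?thesis
    using assms permutes_compose [OF assms(2,1)]
    by (simp add: G_rpqn_def r_coset_C_q [OF r_pos] monomial_mult [OF r_pos])
qed

lemma one_Q: "\<one>\<^bsub>G_rpqn r p q n\<^esub> = cls r q n id (\<lambda>_. 0)"
  by (simp add: G_rpqn_def C_q_eq [OF r_pos] cls_def)

lemma finite_G: "finite (carrier (G_rpn r p n))"
proof -
  let ?A = "{\<pi>. \<pi> permutes {..<n}}"
  have "p * card (carrier (G_rpn r p n)) = card ?A * r ^ n"
    using card_monomials [OF r_pos n_pos p_dvd, of ?A] by (simp add: carrier_G_rpn [OF r_pos p_dvd])
  moreover have "card ?A > 0" by (simp add: card_permutations)
  ultimately have "card (carrier (G_rpn r p n)) > 0"
    using r_pos by (metis mult_0_right nat_0_less_mult_iff neq0_conv zero_less_power)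
  then show ?thesis by (rule card_ge_0_finite)
qed

lemma card_C_q: "card (C_q r q n) = q"
proof -
  have "C_q r q n = {scalar r n a | a. int (r div q) dvd a}"
    unfolding C_q_eq [OF r_pos] by (auto simp: dvd_def)
  moreover have "(r div q) * card {scalar r n a | a. int (r div q) dvd a} = (r div q) * q"
    using card_scalars [OF r_pos n_pos r_div_q_dvd] q_dvd by simp
  ultimately show ?thesis using r_div_q_pos by simp
qed

text \<open>Reduces counting in the quotient to counting matrices: distinct cosets are disjoint and
  each has \<open>q\<close> elements.\<close>

lemma card_Union_Q:
  assumes "A \<subseteq> carrier (G_rpqn r p q n)"
  shows "card (\<Union>A) = q * card A"
proof -
  have A: "A \<subseteq> rcosets\<^bsub>G_rpn r p n\<^esub> (C_q r q n)" using assms by (simp add: G_rpqn_def FactGroup_def)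
  have U: "\<Union>A \<subseteq> carrier (G_rpn r p n)"
    using A N.rcosets_carrier [OF G.is_group] by blast
  have "q * card A = card (\<Union>A)"
  proof (rule card_partition)
    show fin: "finite (\<Union>A)" using U finite_G by (rule finite_subset)
    then show "finite A" by (rule finite_UnionD)
    show "card c = q" if "c \<in> A" for c
      using G.card_rcosets_equal [OF _ C_q_subset, of c] that A card_C_q by auto
    show "c1 \<inter> c2 = {}" if "c1 \<in> A" "c2 \<in> A" "c1 \<noteq> c2" for c1 c2
      using G.rcos_disjoint [OF N.subgroup_axioms] that A by (auto simp: pairwise_def disjnt_def)
  qed
  then show ?thesis ..
qed

lemma finite_Q: "finite (carrier (G_rpqn r p q n))"
  using finite_G by (simp add: G_rpqn_def carrier_FactGroup)

lemma card_Q: "p * q * card (carrier (G_rpqn r p q n)) = fact n * r ^ n"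
proof -
  have "\<Union>(carrier (G_rpqn r p q n)) = carrier (G_rpn r p n)"
    using G.rcosets_part_G [OF N.subgroup_axioms] by (simp add: G_rpqn_def FactGroup_def)
  then have "q * card (carrier (G_rpqn r p q n)) = card (carrier (G_rpn r p n))"
    using card_Union_Q [OF subset_refl] by simp
  moreover have "p * card (carrier (G_rpn r p n)) = fact n * r ^ n"
    using card_monomials [OF r_pos n_pos p_dvd, of "{\<pi>. \<pi> permutes {..<n}}"]
    by (simp add: carrier_G_rpn [OF r_pos p_dvd] card_permutations)
  ultimately show ?thesis by (simp add: mult.assoc)
qed

text \<open>To commute in the quotient is to commute up to \<open>C_q\<close>: the shift
  \<open>t\<close> may depend on \<open>\<sigma>\<close> and \<open>y\<close>, but it is the same
  for all coordinates.\<close>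

lemma cls_central_iff:
  assumes \<pi>: "\<pi> permutes {..<n}" and x: "int p dvd (\<Sum>i<n. x i)"
  shows "(\<forall>h\<in>carrier (G_rpqn r p q n).
      cls r q n \<pi> x \<otimes>\<^bsub>G_rpqn r p q n\<^esub> h = h \<otimes>\<^bsub>G_rpqn r p q n\<^esub> cls r q n \<pi> x) \<longleftrightarrow>
    (\<forall>\<sigma> y. \<sigma> permutes {..<n} \<longrightarrow> int p dvd (\<Sum>i<n. y i) \<longrightarrow> \<pi> \<circ> \<sigma> = \<sigma> \<circ> \<pi> \<and>
      (\<exists>t. \<forall>j<n. [x (\<sigma> j) + y j = y (\<pi> j) + x j + int (r div q) * t] (mod int r)))"
    (is "?L \<longleftrightarrow> ?R")
proof -
  have *: "cls r q n \<pi> x \<otimes>\<^bsub>G_rpqn r p q n\<^esub> cls r q n \<sigma> y = cls r q n \<sigma> y \<otimes>\<^bsub>G_rpqn r p q n\<^esub> cls r q n \<pi> x \<longleftrightarrow>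
    \<pi> \<circ> \<sigma> = \<sigma> \<circ> \<pi> \<and> (\<exists>t. \<forall>j<n. [x (\<sigma> j) + y j = y (\<pi> j) + x j + int (r div q) * t] (mod int r))"
    if "\<sigma> permutes {..<n}" "int p dvd (\<Sum>i<n. y i)" for \<sigma> y
    using that x \<pi> by (simp add: mult_Q cls_eq_iff [OF r_pos] permutes_compose)
  show ?thesis
  proof
    assume ?L
    then show ?R using * cls_in_Q by metis
  next
    assume R: ?R
    show ?L
    proof
      fix h assume "h \<in> carrier (G_rpqn r p q n)"
      then obtain \<sigma> y where "h = cls r q n \<sigma> y" "\<sigma> permutes {..<n}" "int p dvd (\<Sum>i<n. y i)"
        unfolding carrier_Q by blast
      then show "cls r q n \<pi> x \<otimes>\<^bsub>G_rpqn r p q n\<^esub> h = h \<otimes>\<^bsub>G_rpqn r p q n\<^esub> cls r q n \<pi> x"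
        using * R by blast
    qed
  qed
qed

end

section \<open>The centre for \<open>n \<ge> 3\<close>\<close>

definition center :: "('a, 'b) monoid_scheme \<Rightarrow> 'a set" where
  "center G = {z \<in> carrier G. \<forall>h\<in>carrier G. z \<otimes>\<^bsub>G\<^esub> h = h \<otimes>\<^bsub>G\<^esub> z}"

lemma iso_image_center:
  assumes "group G" "group H" "h \<in> iso G H"
  shows "h ` center G = center H"
proof -
  interpret group_hom G H h
    using assms by (auto simp: group_hom_def group_hom_axioms_def iso_def)
  have onto: "h ` carrier G = carrier H" and inj: "inj_on h (carrier G)"
    using assms(3) by (auto simp: Group.iso_iff)
  have "h z \<in> center H \<longleftrightarrow> z \<in> center G" if z: "z \<in> carrier G" for z
  proof -
    have "h z \<otimes>\<^bsub>H\<^esub> h g = h g \<otimes>\<^bsub>H\<^esub> h z \<longleftrightarrow> z \<otimes>\<^bsub>G\<^esub> g = g \<otimes>\<^bsub>G\<^esub> z" if "g \<in> carrier G" for g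
      using z that inj by (simp add: inj_on_eq_iff flip: hom_mult)
    then show ?thesis using z by (simp add: center_def flip: onto)
  qed
  moreover have "center G \<subseteq> carrier G" "center H \<subseteq> h ` carrier G"
    by (auto simp: center_def onto)
  ultimately show ?thesis by blast
qed

lemma iso_image_center_involutions:
  assumes "group G" "group H" "h \<in> iso G H"
  shows "h ` {z \<in> center G. z \<otimes>\<^bsub>G\<^esub> z = \<one>\<^bsub>G\<^esub>} = {z \<in> center H. z \<otimes>\<^bsub>H\<^esub> z = \<one>\<^bsub>H\<^esub>}"
proof -
  interpret group_hom G H h
    using assms by (auto simp: group_hom_def group_hom_axioms_def iso_def)
  have inj: "inj_on h (carrier G)"
    using assms(3) by (auto simp: Group.iso_iff)
  have "h z \<otimes>\<^bsub>H\<^esub> h z = \<one>\<^bsub>H\<^esub> \<longleftrightarrow> z \<otimes>\<^bsub>G\<^esub> z = \<one>\<^bsub>G\<^esub>" if "z \<in> carrier G" for z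
    using that inj_on_eq_iff [OF inj, of "z \<otimes>\<^bsub>G\<^esub> z" "\<one>\<^bsub>G\<^esub>"] by simp
  moreover have "center G \<subseteq> carrier G" by (auto simp: center_def)
  ultimately show ?thesis
    by (auto simp flip: iso_image_center [OF assms])
qed

lemma iso_card_center:
  assumes "group G" "group H" "G \<cong> H"
  shows "card (center G) = card (center H)"
    and "card {z \<in> center G. z \<otimes>\<^bsub>G\<^esub> z = \<one>\<^bsub>G\<^esub>} = card {z \<in> center H. z \<otimes>\<^bsub>H\<^esub> z = \<one>\<^bsub>H\<^esub>}"
    and "card (derived G (carrier G)) = card (derived H (carrier H))"
proof -
  obtain h where h: "h \<in> iso G H" using assms(3) by (auto simp: is_iso_def)
  have inj: "inj_on h (carrier G)" and onto: "h ` carrier G = carrier H" and hom: "h \<in> hom G H"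
    using h by (auto simp: Group.iso_iff)
  have sub: "center G \<subseteq> carrier G" by (auto simp: center_def)
  show "card (center G) = card (center H)"
    using card_image [OF inj_on_subset [OF inj sub]] by (simp add: iso_image_center [OF assms(1,2) h])
  have sub: "{z \<in> center G. z \<otimes>\<^bsub>G\<^esub> z = \<one>\<^bsub>G\<^esub>} \<subseteq> carrier G" using sub by blast
  show "card {z \<in> center G. z \<otimes>\<^bsub>G\<^esub> z = \<one>\<^bsub>G\<^esub>} = card {z \<in> center H. z \<otimes>\<^bsub>H\<^esub> z = \<one>\<^bsub>H\<^esub>}"
    using card_image [OF inj_on_subset [OF inj sub]]
    by (simp add: iso_image_center_involutions [OF assms(1,2) h])
  have "group_hom G H h" using assms(1,2) hom by (simp add: group_hom_def group_hom_axioms_def)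
  then have "derived H (carrier H) = h ` derived G (carrier G)"
    using group_hom.derived_img [of G H h "carrier G"] onto by simp
  moreover have "derived G (carrier G) \<subseteq> carrier G"
    using group.derived_in_carrier [OF assms(1)] by blast
  ultimately show "card (derived G (carrier G)) = card (derived H (carrier H))"
    using card_image inj_on_subset [OF inj] by metis
qed

lemma dvd_sum_cong:
  fixes x y :: "nat \<Rightarrow> int"
  assumes "p dvd r" "\<And>j. j < n \<Longrightarrow> [x j = y j] (mod r)"
  shows "p dvd (\<Sum>j<n. x j) \<longleftrightarrow> p dvd (\<Sum>j<n. y j)"
proof -
  have "[(\<Sum>j<n. x j) = (\<Sum>j<n. y j)] (mod r)" using assms(2) by (intro cong_sum) auto
  then show ?thesis using assms(1) cong_dvd_iff cong_dvd_modulus by blast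
qed

lemma mult_div_gcd_dvd_iff:
  fixes p n :: nat
  assumes "p > 0"
  shows "int p dvd int n * a \<longleftrightarrow> int (p div gcd p n) dvd a"
proof -
  let ?g = "gcd p n"
  have "?g > 0" using assms by simp
  have p: "int p = int ?g * int (p div ?g)" and n: "int n = int ?g * int (n div ?g)"
    by (simp_all flip: of_nat_mult)
  have "coprime (int (p div ?g)) (int (n div ?g))"
    using assms div_gcd_coprime [of p n] by simp
  have "int p dvd int n * a \<longleftrightarrow> int ?g * int (p div ?g) dvd int ?g * (int (n div ?g) * a)"
    by (simp flip: p n mult.assoc)
  also have "\<dots> \<longleftrightarrow> int (p div ?g) dvd int (n div ?g) * a"
    using \<open>?g > 0\<close> by (subst dvd_mult_cancel_left) auto
  also have "\<dots> \<longleftrightarrow> int (p div ?g) dvd a"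
    using \<open>coprime _ _\<close> by (simp add: coprime_dvd_mult_right_iff)
  finally show ?thesis .
qed

context projective_reflection_group
begin

lemma monomial_in_cls: "monomial r n \<pi> x \<in> cls r q n \<pi> x"
  unfolding cls_def by (rule CollectI, intro exI [of _ 0]) simp

lemma cls_scalar_eq:
  assumes "\<And>j. j < n \<Longrightarrow> [x j = a] (mod int r)"
  shows "cls r q n id x = cls r q n id (\<lambda>_. a)"
  using assms by (subst cls_eq_iff [OF r_pos permutes_id permutes_id]) (auto intro!: exI [of _ 0])

lemma in_center_iff:
  assumes \<pi>: "\<pi> permutes {..<n}" and x: "int p dvd (\<Sum>i<n. x i)"
  shows "cls r q n \<pi> x \<in> center (G_rpqn r p q n) \<longleftrightarrow>
    (\<forall>\<sigma> y. \<sigma> permutes {..<n} \<longrightarrow> int p dvd (\<Sum>i<n. y i) \<longrightarrow> \<pi> \<circ> \<sigma> = \<sigma> \<circ> \<pi> \<and>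
      (\<exists>t. \<forall>j<n. [x (\<sigma> j) + y j = y (\<pi> j) + x j + int (r div q) * t] (mod int r)))"
  unfolding center_def using cls_central_iff [OF assms] cls_in_Q [OF assms] by blast

lemma scalar_in_center:
  assumes "int p dvd int n * a"
  shows "cls r q n id (\<lambda>_. a) \<in> center (G_rpqn r p q n)"
  using assms by (subst in_center_iff) (auto simp: permutes_id add.commute intro!: exI [of _ 0])

definition scalars :: "complex mat set set" where
  "scalars = {cls r q n id (\<lambda>_. a) | a. int p dvd int n * a}"

lemma scalars_subset_center: "scalars \<subseteq> center (G_rpqn r p q n)"
  using scalar_in_center by (auto simp: scalars_def)

text \<open>The matrices in these classes are the scalars whose exponent is a multiple of
  \<open>p div gcd p n\<close>. There are \<open>r * gcd p n / p\<close> of them, and each class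
  holds \<open>q\<close>.\<close>

lemma card_scalar_classes: "p * q * card scalars = r * gcd p n"
proof -
  let ?d = "p div gcd p n"
  have "\<Union>scalars = {scalar r n a | a. int ?d dvd a}"
  proof (intro equalityI subsetI)
    fix g assume "g \<in> \<Union>scalars"
    then obtain a t where "int p dvd int n * a" and g: "g = scalar r n (a + int (r div q) * t)"
      by (auto simp: scalars_def cls_def)
    moreover have "int p dvd int n * (int (r div q) * t)"
    proof -
      have "int p dvd int n * int (r div q)" using p_dvd_n_r_div_q by (simp flip: of_nat_mult)
      from dvd_mult2 [OF this, of t] show ?thesis by (simp only: mult.assoc)
    qed
    ultimately have "int p dvd int n * (a + int (r div q) * t)"
      by (simp add: distrib_left)
    then show "g \<in> {scalar r n a | a. int ?d dvd a}"
      unfolding g mult_div_gcd_dvd_iff [OF p_pos] by blast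
  next
    fix g assume "g \<in> {scalar r n a | a. int ?d dvd a}"
    then show "g \<in> \<Union>scalars"
      using monomial_in_cls by (auto simp: scalars_def mult_div_gcd_dvd_iff [OF p_pos])
  qed
  moreover have "card (\<Union>scalars) = q * card scalars"
    using scalars_subset_center by (intro card_Union_Q) (auto simp: center_def)
  moreover have d: "?d * gcd p n = p" by simp
  then have "?d dvd r" using p_dvd by (metis dvd_mult_left)
  ultimately have "?d * (q * card scalars) = r"
    using card_scalars [OF r_pos n_pos, of ?d] by simp
  have "?d * gcd p n * q * card scalars = ?d * (q * card scalars) * gcd p n"
    by (simp only: ac_simps)
  also have "\<dots> = r * gcd p n" by (simp only: \<open>?d * (q * card scalars) = r\<close>)
  finally show ?thesis unfolding d .
qed

text \<open>If \<open>\<pi>\<close> moves \<open>i\<close>, the transposition of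
  \<open>\<pi> i\<close> with a third point \<open>k\<close> fixes \<open>i\<close>; comparing both
  products at \<open>i\<close> would give \<open>\<pi> i = k\<close>.\<close>

lemma commuting_permutation_id:
  assumes "n \<ge> 3" "\<pi> permutes {..<n}" "\<And>\<sigma>. \<sigma> permutes {..<n} \<Longrightarrow> \<pi> \<circ> \<sigma> = \<sigma> \<circ> \<pi>"
  shows "\<pi> = id"
proof
  fix i show "\<pi> i = id i"
  proof (rule ccontr)
    assume ne: "\<pi> i \<noteq> id i"
    then have "i < n" using assms(2) by (auto simp: permutes_def)
    then have "\<pi> i < n" using assms(2) by (simp add: permutes_lessThan_lt)
    have "card {i, \<pi> i} < card {..<n}" using assms(1) by (simp add: card_insert_if)
    then have "\<not> {..<n} \<subseteq> {i, \<pi> i}" by (meson card_mono finite.emptyI finite.insertI not_le)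
    then obtain k where k: "k < n" "k \<noteq> i" "k \<noteq> \<pi> i" by auto
    have "Transposition.transpose (\<pi> i) k permutes {..<n}"
      using k \<open>\<pi> i < n\<close> by (intro permutes_swap_id) auto
    from fun_cong [OF assms(3) [OF this], of i] show False
      using k ne by (simp add: Transposition.transpose_def split: if_splits)
  qed
qed

lemma center_eq_scalars:
  assumes "n \<ge> 3"
  shows "center (G_rpqn r p q n) = scalars"
proof (intro equalityI subsetI)
  fix z assume z: "z \<in> center (G_rpqn r p q n)"
  then obtain \<pi> x where z_eq: "z = cls r q n \<pi> x" and \<pi>: "\<pi> permutes {..<n}"
    and x: "int p dvd (\<Sum>i<n. x i)" by (auto simp: center_def carrier_Q)
  have *: "\<pi> \<circ> \<sigma> = \<sigma> \<circ> \<pi> \<and> (\<exists>t. \<forall>j<n. [x (\<sigma> j) = x j + int (r div q) * t] (mod int r))"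
    if "\<sigma> permutes {..<n}" for \<sigma>
    \<comment> \<open>Testing against pure permutation matrices, \<open>y = 0\<close>, already
      suffices.\<close>
    using z that unfolding z_eq in_center_iff [OF \<pi> x] by (force dest: spec [where x = "\<lambda>_. 0"])
  have "\<pi> = id" using commuting_permutation_id [OF assms \<pi>] * by blast
  have cong: "[x k = x 0] (mod int r)" if "k < n" for k
  proof -
    have "card {0, k} < card {..<n}" using assms by (simp add: card_insert_if)
    then have "\<not> {..<n} \<subseteq> {0, k}" by (meson card_mono finite.emptyI finite.insertI not_le)
    \<comment> \<open>The transposition of 0 and \<open>k\<close> fixes \<open>l\<close>, so the
      congruence at \<open>l\<close> says that the shift is zero modulo \<open>r\<close>; the
      congruence at 0 then compares \<open>x k\<close> with \<open>x 0\<close>.\<close>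
    then obtain l where l: "l < n" "l \<noteq> 0" "l \<noteq> k" by auto
    have "Transposition.transpose 0 k permutes {..<n}" using that n_pos by (intro permutes_swap_id) auto
    from * [OF this] obtain t
      where t: "\<And>j. j < n \<Longrightarrow> [x (Transposition.transpose 0 k j) = x j + int (r div q) * t] (mod int r)" by blast
    from t [OF l(1)] have "[x l + 0 = x l + int (r div q) * t] (mod int r)"
      using l by (simp add: Transposition.transpose_def)
    then have "[0 = int (r div q) * t] (mod int r)" by (simp only: cong_add_lcancel)
    then have "[x 0 + int (r div q) * t = x 0 + 0] (mod int r)"
      by (intro cong_add cong_refl) (rule cong_sym)
    moreover have "[x k = x 0 + int (r div q) * t] (mod int r)"
      using t [OF n_pos] by simp
    ultimately show ?thesis by (metis add.right_neutral cong_trans)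
  qed
  have "int p dvd int n * x 0"
    using x dvd_sum_cong [of "int p" "int r" n x "\<lambda>_. x 0"] cong p_dvd by simp
  then show "z \<in> scalars"
    unfolding z_eq \<open>\<pi> = id\<close> scalars_def using cls_scalar_eq [of x "x 0"] cong by blast
next
  fix z assume "z \<in> scalars" then show "z \<in> center (G_rpqn r p q n)"
    using scalars_subset_center by blast
qed

end

section \<open>The derived subgroup for \<open>n \<ge> 3\<close>\<close>

text \<open>This is the alternating group. In the comparison of two quotients its order is a
  positive common factor that cancels.\<close>

abbreviation perm_derived :: "nat \<Rightarrow> (nat \<Rightarrow> nat) set" where
  "perm_derived n \<equiv> derived (perm_group n) (carrier (perm_group n))"

lemma subgroup_perm_derived: "subgroup (perm_derived n) (perm_group n)"
  by (rule group.derived_is_subgroup [OF group_perm_group subset_refl])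

lemma perm_derived_permutes: "\<pi> \<in> perm_derived n \<Longrightarrow> \<pi> permutes {..<n}"
  using subgroup.mem_carrier [OF subgroup_perm_derived] by simp

lemma card_perm_derived_pos: "card (perm_derived n) > 0"
proof -
  have "perm_derived n \<subseteq> {\<pi>. \<pi> permutes {..<n}}" using perm_derived_permutes by blast
  then have "finite (perm_derived n)" using finite_permutations by (rule finite_subset) simp
  moreover have "id \<in> perm_derived n"
    using subgroup.one_closed [OF subgroup_perm_derived] by simp
  ultimately show ?thesis by (auto simp: card_gt_0_iff)
qed

text \<open>Hides the exponents of a product and keeps only their sum, which is all that matters for
  a commutator of four factors.\<close>

lemma sum_monomial_mult:
  assumes "r > 0" "\<sigma> permutes {..<n}"
  obtains z where "monomial r n \<pi> x * monomial r n \<sigma> y = monomial r n (\<pi> \<circ> \<sigma>) z"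
    and "(\<Sum>i<n. z i) = (\<Sum>i<n. x i) + (\<Sum>i<n. y i)"
  using monomial_mult [OF assms, of \<pi> x y] sum_permutes [OF assms(2), of x]
  by (simp add: sum.distrib)

context projective_reflection_group
begin

lemma monomial_in_G:
  "\<pi> permutes {..<n} \<Longrightarrow> int p dvd (\<Sum>i<n. x i) \<Longrightarrow> monomial r n \<pi> x \<in> carrier (G_rpn r p n)"
  by (simp add: monomial_in_G_rpn_iff [OF r_pos p_dvd])

lemma inv_monomial_G:
  assumes "\<pi> permutes {..<n}" "int p dvd (\<Sum>i<n. x i)"
  shows "inv\<^bsub>G_rpn r p n\<^esub> (monomial r n \<pi> x)
    = monomial r n (Hilbert_Choice.inv \<pi>) (\<lambda>j. - x (Hilbert_Choice.inv \<pi> j))"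
proof (rule G.inv_equality)
  show "monomial r n (Hilbert_Choice.inv \<pi>) (\<lambda>j. - x (Hilbert_Choice.inv \<pi> j))
      \<in> carrier (G_rpn r p n)"
    using assms sum_permutes [OF permutes_inv [OF assms(1)], of x]
    by (intro monomial_in_G permutes_inv) (simp_all add: sum_negf)
qed (use assms monomial_inverse [OF r_pos assms(1), of x] monomial_in_G in auto)

text \<open>The exponent sums of \<open>g\<close> and \<open>h\<close> cancel against those of their
  inverses, so the sum of the commutator is 0. It is stated modulo \<open>r\<close> because the
  matrix determines the exponents only up to multiples of \<open>r\<close>.\<close>

lemma derived_set_G_subset:
  "derived_set (G_rpn r p n) (carrier (G_rpn r p n))
    \<subseteq> {monomial r n \<pi> x | \<pi> x. \<pi> \<in> perm_derived n \<and> int r dvd (\<Sum>i<n. x i)}"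
proof
  fix u assume "u \<in> derived_set (G_rpn r p n) (carrier (G_rpn r p n))"
  then obtain g h where "g \<in> carrier (G_rpn r p n)" "h \<in> carrier (G_rpn r p n)"
    and u: "u = g * h * inv\<^bsub>G_rpn r p n\<^esub> g * inv\<^bsub>G_rpn r p n\<^esub> h" by auto
  then obtain \<pi> x \<sigma> y where g: "g = monomial r n \<pi> x" "\<pi> permutes {..<n}" "int p dvd (\<Sum>i<n. x i)"
    and h: "h = monomial r n \<sigma> y" "\<sigma> permutes {..<n}" "int p dvd (\<Sum>i<n. y i)"
    unfolding carrier_G_rpn [OF r_pos p_dvd] by blast
  let ?x = "\<lambda>j. - x (Hilbert_Choice.inv \<pi> j)" and ?y = "\<lambda>j. - y (Hilbert_Choice.inv \<sigma> j)"
  have \<pi>': "Hilbert_Choice.inv \<pi> permutes {..<n}" and \<sigma>': "Hilbert_Choice.inv \<sigma> permutes {..<n}"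
    using g h by (auto intro: permutes_inv)
  obtain z1 where z1: "g * h = monomial r n (\<pi> \<circ> \<sigma>) z1"
    "(\<Sum>i<n. z1 i) = (\<Sum>i<n. x i) + (\<Sum>i<n. y i)"
    unfolding g(1) h(1) by (rule sum_monomial_mult [OF r_pos h(2)])
  obtain z2 where z2: "monomial r n (\<pi> \<circ> \<sigma>) z1 * monomial r n (Hilbert_Choice.inv \<pi>) ?x
      = monomial r n (\<pi> \<circ> \<sigma> \<circ> Hilbert_Choice.inv \<pi>) z2"
    "(\<Sum>i<n. z2 i) = (\<Sum>i<n. z1 i) + (\<Sum>i<n. ?x i)"
    by (rule sum_monomial_mult [OF r_pos \<pi>'])
  obtain z3 where z3: "monomial r n (\<pi> \<circ> \<sigma> \<circ> Hilbert_Choice.inv \<pi>) z2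
        * monomial r n (Hilbert_Choice.inv \<sigma>) ?y
      = monomial r n (\<pi> \<circ> \<sigma> \<circ> Hilbert_Choice.inv \<pi> \<circ> Hilbert_Choice.inv \<sigma>) z3"
    "(\<Sum>i<n. z3 i) = (\<Sum>i<n. z2 i) + (\<Sum>i<n. ?y i)"
    by (rule sum_monomial_mult [OF r_pos \<sigma>'])
  have "u = monomial r n (\<pi> \<circ> \<sigma> \<circ> Hilbert_Choice.inv \<pi> \<circ> Hilbert_Choice.inv \<sigma>) z3"
    using g h by (simp add: u inv_monomial_G z1(1) [unfolded g(1) h(1)] z2(1) z3(1))
  moreover have "(\<Sum>i<n. z3 i) = 0"
    using sum_permutes [OF \<pi>', of x] sum_permutes [OF \<sigma>', of y]
    by (simp add: z1(2) z2(2) z3(2) sum_negf)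
  moreover have "\<pi> \<circ> \<sigma> \<circ> Hilbert_Choice.inv \<pi> \<circ> Hilbert_Choice.inv \<sigma> \<in> perm_derived n"
    unfolding derived_def
    using g h inv_perm_group by (intro generate.incl) fastforce
  ultimately show "u \<in> {monomial r n \<pi> x | \<pi> x. \<pi> \<in> perm_derived n \<and> int r dvd (\<Sum>i<n. x i)}"
    by force
qed

abbreviation "DG \<equiv> derived (G_rpn r p n) (carrier (G_rpn r p n))"

lemma subgroup_DG: "subgroup DG (G_rpn r p n)"
  by (rule G.derived_is_subgroup [OF subset_refl])

text \<open>Permutation matrices embed the symmetric group into G(r,p,n), and a homomorphism carries
  derived subgroups into derived subgroups.\<close>

lemma permutation_in_derived:
  assumes "\<pi> \<in> perm_derived n"
  shows "monomial r n \<pi> (\<lambda>_. 0) \<in> DG"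
proof -
  let ?h = "\<lambda>\<pi>. monomial r n \<pi> (\<lambda>_. 0)"
  have "?h \<in> hom (perm_group n) (G_rpn r p n)"
    by (auto simp: hom_def monomial_mult [OF r_pos] intro!: monomial_in_G)
  then have "group_hom (perm_group n) (G_rpn r p n) ?h"
    by (simp add: group_hom_def group_hom_axioms_def group_perm_group G.is_group)
  from group_hom.derived_img [OF this subset_refl]
  have "?h ` perm_derived n = derived (G_rpn r p n) (?h ` carrier (perm_group n))" ..
  also have "\<dots> \<subseteq> DG" by (intro G.mono_derived) (auto intro!: monomial_in_G)
  finally show ?thesis using assms by blast
qed

lemma elementary_in_derived:
  assumes "n \<ge> 3" "0 < i" "i < n"
  shows "monomial r n id ((\<lambda>_. 0)(0 := - a, i := a)) \<in> DG"
proof -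
  have "card {0, i} < card {..<n}" using assms by (simp add: card_insert_if)
  then have "\<not> {..<n} \<subseteq> {0, i}" by (meson card_mono finite.emptyI finite.insertI not_le)
  then obtain l where l: "l < n" "l \<noteq> 0" "l \<noteq> i" by auto
  \<comment> \<open>The desired matrix is the commutator of the permutation matrix of
    \<open>?\<sigma>\<close> with the diagonal \<open>?u\<close>. The entry at the third index
    \<open>l\<close> brings the sum of \<open>?u\<close> to 0, so that it lies in G(r,p,n) for every
    \<open>p\<close>; as \<open>?\<sigma>\<close> fixes \<open>l\<close>, this entry cancels in the
    commutator.\<close>
  let ?\<sigma> = "Transposition.transpose 0 i" and ?u = "(\<lambda>_. 0)(0 := a, l := - a)"
  have \<sigma>: "?\<sigma> permutes {..<n}" using assms by (intro permutes_swap_id) auto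
  have sum_u: "(\<Sum>j<n. ?u j) = 0"
  proof -
    have "(\<Sum>j<n. ?u j) = (\<Sum>j<n. (if j = 0 then a else 0) + (if j = l then - a else 0))"
      using l by (intro sum.cong) auto
    also have "\<dots> = 0" using l assms by (simp add: sum.distrib)
    finally show ?thesis .
  qed
  let ?g = "monomial r n ?\<sigma> (\<lambda>_. 0)" and ?h = "monomial r n id ?u"
  have g: "?g \<in> carrier (G_rpn r p n)" and h: "?h \<in> carrier (G_rpn r p n)"
    using \<sigma> sum_u by (auto intro!: monomial_in_G simp del: fun_upd_apply simp: permutes_id)
  have "inv\<^bsub>G_rpn r p n\<^esub> ?g = ?g"
    using inv_monomial_G [OF \<sigma>, of "\<lambda>_. 0"] by (simp add: inv_unique_comp)
  moreover have "inv\<^bsub>G_rpn r p n\<^esub> ?h = monomial r n id (\<lambda>j. - ?u j)"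
    using inv_monomial_G [OF permutes_id, of ?u] sum_u by (simp del: fun_upd_apply)
  moreover have "?g * ?h * ?g * monomial r n id (\<lambda>j. - ?u j)
      = monomial r n id (\<lambda>j. ?u (?\<sigma> j) - ?u j)"
    using \<sigma> by (simp add: monomial_mult r_pos permutes_id del: fun_upd_apply)
  ultimately have "?g * ?h * inv\<^bsub>G_rpn r p n\<^esub> ?g * inv\<^bsub>G_rpn r p n\<^esub> ?h
      = monomial r n id (\<lambda>j. ?u (?\<sigma> j) - ?u j)" by simp
  also have "(\<lambda>j. ?u (?\<sigma> j) - ?u j) = (\<lambda>_. 0)(0 := - a, i := a)"
    using l assms by (auto simp: fun_eq_iff Transposition.transpose_def)
  finally have "monomial r n id ((\<lambda>_. 0)(0 := - a, i := a))
      = ?g * ?h * inv\<^bsub>G_rpn r p n\<^esub> ?g * inv\<^bsub>G_rpn r p n\<^esub> ?h" ..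
  with g h have "monomial r n id ((\<lambda>_. 0)(0 := - a, i := a))
      \<in> derived_set (G_rpn r p n) (carrier (G_rpn r p n))" by auto
  then show ?thesis unfolding derived_def by (rule generate.incl)
qed

text \<open>Elementary factors move the exponent at the last index into coordinate 0, one index at a
  time. In the end only coordinate 0 is left; it carries the whole sum, a multiple of
  \<open>r\<close>, and the matrix is the identity.\<close>

lemma diagonal_in_derived:
  assumes n: "n \<ge> 3" and y: "int r dvd (\<Sum>i<n. y i)"
  shows "monomial r n id y \<in> DG"
proof -
  have "monomial r n id y \<in> DG"
    if "int r dvd (\<Sum>i<n. y i)" "\<And>j. Suc k \<le> j \<Longrightarrow> j < n \<Longrightarrow> y j = 0" "Suc k \<le> n" for k y
    using that
  proof (induction k arbitrary: y)
    case 0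
    have "(\<Sum>i<n. y i) = y 0 + (\<Sum>i\<in>{..<n} - {0}. y i)"
      using n_pos by (intro sum.remove) auto
    also have "(\<Sum>i\<in>{..<n} - {0}. y i) = 0" using 0 by (intro sum.neutral) auto
    finally have "int r dvd y 0" using 0 by simp
    then have "[y j = 0] (mod int r)" if "j < n" for j
      using that 0(2) [of j] by (cases "j = 0") (auto simp: cong_0_iff)
    then have "monomial r n id y = \<one>\<^bsub>G_rpn r p n\<^esub>"
      by (simp add: monomial_eq_iff r_pos permutes_id flip: monomial_one [of r n])
    then show ?case using subgroup.one_closed [OF subgroup_DG] by (simp add: id_def)
  next
    case (Suc k)
    let ?a = "y (Suc k)"
    let ?y = "y(0 := y 0 + ?a, Suc k := 0)"
    let ?e = "(\<lambda>_. 0)(0 := - ?a, Suc k := ?a)"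
    have "(\<Sum>i<n. ?y i) = (\<Sum>i<n. y i + (if i = 0 then ?a else 0) + (if i = Suc k then - ?a else 0))"
      by (intro sum.cong) auto
    also have "\<dots> = (\<Sum>i<n. y i)" using Suc.prems n_pos by (simp add: sum.distrib)
    finally have "int r dvd (\<Sum>i<n. ?y i)" using Suc.prems by simp
    then have "monomial r n id ?y \<in> DG"
      using Suc.prems by (intro Suc.IH) (auto simp: Suc_le_eq)
    moreover have "monomial r n id ?e \<in> DG"
      using Suc.prems by (intro elementary_in_derived n) auto
    moreover have "monomial r n id ?y * monomial r n id ?e = monomial r n id y"
      by (simp add: monomial_mult r_pos permutes_id, rule arg_cong [where f = "monomial r n id"]) auto
    ultimately show ?case using subgroup.m_closed [OF subgroup_DG] by (metis mult_G_rpn)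
  qed
  from this [of y "n - 1"] show ?thesis using y n_pos by simp
qed

lemma derived_G:
  assumes "n \<ge> 3"
  shows "DG = {monomial r n \<pi> x | \<pi> x. \<pi> \<in> perm_derived n \<and> int r dvd (\<Sum>i<n. x i)}" (is "_ = ?E")
proof
  have eq: "G_rpn r p n = (G_rn r n)\<lparr>carrier := carrier (G_rpn r p n)\<rparr>"
    by (simp add: G_rpn_def)
  have "?E \<subseteq> carrier (G_rpn r p n)"
    using perm_derived_permutes p_dvd by (auto intro!: monomial_in_G elim: dvd_trans [rotated])
  then have "subgroup ?E ((G_rn r n)\<lparr>carrier := carrier (G_rpn r p n)\<rparr>)"
    using group.subgroup_incl [OF group_G_rn [OF r_pos]
        subgroup_monomials [OF r_pos subgroup_perm_derived] subgroup_G_rpn [OF r_pos p_dvd]] by blast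
  then have "subgroup ?E (G_rpn r p n)" by (subst eq)
  then show "DG \<subseteq> ?E"
    unfolding derived_def using derived_set_G_subset [unfolded derived_def]
    by (intro G.generate_subgroup_incl)
  show "?E \<subseteq> DG"
  proof
    fix g assume "g \<in> ?E"
    then obtain \<pi> x where g: "g = monomial r n \<pi> x" "\<pi> \<in> perm_derived n" "int r dvd (\<Sum>i<n. x i)"
      by blast
    have "monomial r n \<pi> (\<lambda>_. 0) \<otimes>\<^bsub>G_rpn r p n\<^esub> monomial r n id x \<in> DG"
      using g assms by (intro subgroup.m_closed [OF subgroup_DG] permutation_in_derived diagonal_in_derived)
    then show "g \<in> DG" by (simp add: g(1) monomial_mult r_pos permutes_id)
  qed
qed

text \<open>The derived subgroup of the quotient is the image of that of G(r,p,n).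
  \<open>C_q\<close> changes the exponent sum by multiples of \<open>n * (r div q)\<close>, so the
  matrices above it are those whose sum is divisible by \<open>?m\<close>, and
  \<open>?m * q = gcd (r * q) (r * n) = r * gcd q n\<close>.\<close>

lemma card_derived_Q:
  assumes "n \<ge> 3"
  shows "r * gcd q n * card (derived (G_rpqn r p q n) (carrier (G_rpqn r p q n)))
    = card (perm_derived n) * r ^ n"
proof -
  let ?D = "derived (G_rpqn r p q n) (carrier (G_rpqn r p q n))"
  let ?c = "\<lambda>g. C_q r q n #>\<^bsub>G_rpn r p n\<^esub> g"
  let ?m = "gcd r (n * (r div q))"
  have "group_hom (G_rpn r p n) (G_rpqn r p q n) ?c"
    using N.r_coset_hom_Mod group_Q
    by (simp add: group_hom_def group_hom_axioms_def G.is_group G_rpqn_def)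
  from group_hom.derived_img [OF this subset_refl]
  have "?D = ?c ` DG" by (simp add: G_rpqn_def carrier_FactGroup)
  also have "\<dots> = {cls r q n \<pi> x | \<pi> x. \<pi> \<in> perm_derived n \<and> int r dvd (\<Sum>i<n. x i)}"
    unfolding derived_G [OF assms] using perm_derived_permutes
    by (force simp: r_coset_C_q [OF r_pos])
  finally have D: "?D = {cls r q n \<pi> x | \<pi> x. \<pi> \<in> perm_derived n \<and> int r dvd (\<Sum>i<n. x i)}" .
  have "\<Union>?D = {monomial r n \<pi> x | \<pi> x. \<pi> \<in> perm_derived n \<and> int ?m dvd (\<Sum>i<n. x i)}"
  proof (intro equalityI subsetI)
    fix g assume "g \<in> \<Union>?D"
    then obtain \<pi> x t where g: "g = monomial r n \<pi> (\<lambda>j. x j + int (r div q) * t)"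
      and \<pi>: "\<pi> \<in> perm_derived n" and x: "int r dvd (\<Sum>i<n. x i)"
      unfolding D cls_def by blast
    have "int ?m dvd (\<Sum>i<n. x i)" using x by (rule dvd_trans [rotated]) simp
    moreover have "int ?m dvd int (n * (r div q)) * t"
      by (intro dvd_mult2) (simp only: int_dvd_int_iff gcd_dvd2)
    ultimately have "int ?m dvd (\<Sum>i<n. x i + int (r div q) * t)"
      by (simp add: sum.distrib mult.assoc)
    then show "g \<in> {monomial r n \<pi> x | \<pi> x. \<pi> \<in> perm_derived n \<and> int ?m dvd (\<Sum>i<n. x i)}"
      using g \<pi> by blast
  next
    fix g assume "g \<in> {monomial r n \<pi> x | \<pi> x. \<pi> \<in> perm_derived n \<and> int ?m dvd (\<Sum>i<n. x i)}"
    then obtain \<pi> x where g: "g = monomial r n \<pi> x"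
      and \<pi>: "\<pi> \<in> perm_derived n" and x: "int ?m dvd (\<Sum>i<n. x i)" by blast
    obtain k where k: "(\<Sum>i<n. x i) = int ?m * k" using x by blast
    \<comment> \<open>Bezout splits the sum into a multiple of \<open>r\<close> and a multiple of
      \<open>n * (r div q)\<close>; the latter is removed by a shift within the coset.\<close>
    obtain u v where uv: "u * int r + v * int (n * (r div q)) = int ?m"
      using bezout_int [of "int r" "int (n * (r div q))"] by (metis gcd_int_int_eq)
    have eq: "(\<Sum>i<n. x i) = int r * (u * k) + int n * (int (r div q) * (v * k))"
      unfolding k uv [symmetric] by (simp add: algebra_simps)
    have "cls r q n \<pi> (\<lambda>j. x j - int (r div q) * (v * k)) \<in> ?D"
      unfolding D using \<pi> eq by (force simp: sum_subtractf)
    moreover have "g \<in> cls r q n \<pi> (\<lambda>j. x j - int (r div q) * (v * k))"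
      unfolding cls_def g by (rule CollectI, intro exI [of _ "v * k"]) simp
    ultimately show "g \<in> \<Union>?D" by blast
  qed
  moreover have "card (\<Union>?D) = q * card ?D"
    by (intro card_Union_Q group.derived_in_carrier [OF group_Q subset_refl])
  moreover have "?m * card {monomial r n \<pi> x | \<pi> x. \<pi> \<in> perm_derived n \<and> int ?m dvd (\<Sum>i<n. x i)}
      = card (perm_derived n) * r ^ n"
    using perm_derived_permutes by (intro card_monomials r_pos n_pos) auto
  ultimately have "?m * q * card ?D = card (perm_derived n) * r ^ n" by (simp add: mult.assoc)
  moreover have "?m * q = r * gcd q n"
  proof -
    have "gcd r (n * (r div q)) * q = gcd (r * q) (n * (r div q) * q)"
      by (simp add: gcd_mult_distrib_nat mult.commute)
    also have "n * (r div q) * q = r * n" using q_dvd by (simp add: mult.assoc mult.commute)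
    finally show ?thesis by (simp add: gcd_mult_distrib_nat)
  qed
  ultimately show ?thesis by simp
qed

end

section \<open>The centre for \<open>n = 2\<close>\<close>

lemma permutes_lessThan_2: "\<pi> permutes {..<2 :: nat} \<Longrightarrow> \<pi> = id \<or> \<pi> = Transposition.transpose 0 1"
  using permutes_doubleton_iff [of \<pi> 0 1] by (simp add: lessThan_nat_numeral lessThan_Suc numeral_2_eq_2 insert_commute)

lemma all_less_2: "(\<forall>j<2. P j) \<longleftrightarrow> P 0 \<and> P (1 :: nat)"
  by (auto simp: less_2_cases_iff)

lemma sum_less_2: "(\<Sum>i<2. f i) = f 0 + f (1 :: nat)"
  by (simp add: numeral_2_eq_2)

lemma int_half: "even m \<Longrightarrow> int m = 2 * int (m div 2)"
  by (auto elim!: evenE)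

context projective_reflection_group
begin

lemma twice_coset_step:
  assumes "odd q" "int r dvd 2 * (int (r div q) * t)"
  shows "int r dvd int (r div q) * t"
proof -
  have "int (r div q) * int q dvd int (r div q) * (2 * t)"
    using assms(2) by (simp add: r_div_q mult.left_commute)
  then have "int q dvd 2 * t" using r_div_q_pos by simp
  moreover have "coprime (int q) 2" using assms(1) by simp
  ultimately have "int q dvd t" by (simp add: coprime_dvd_mult_right_iff)
  then have "int (r div q) * int q dvd int (r div q) * t" by simp
  then show ?thesis by (simp add: r_div_q)
qed

text \<open>Commuting with the transposition makes \<open>x 0 - x 1\<close> and its negative
  congruent to the same shift. Their difference gives the bound on \<open>2 * (x 0 - x 1)\<close>;
  their sum shows that twice the shift vanishes, which kills the shift itself for odd
  \<open>q\<close>.\<close>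

lemma center_rank_2:
  assumes n: "n = 2" and r: "4 dvd r" and pq: "odd p \<or> odd q"
    and \<pi>: "\<pi> permutes {..<n}" and x: "int p dvd (\<Sum>i<n. x i)"
    and z: "cls r q n \<pi> x \<in> center (G_rpqn r p q n)"
  shows "\<pi> = id" and "int r dvd 2 * (x 0 - x 1)" and "odd q \<Longrightarrow> [x 0 = x 1] (mod int r)"
proof -
  let ?e = "int (r div q)"
  have comm: "\<exists>t. \<forall>j<2. [x (\<sigma> j) + y j = y (\<pi> j) + x j + ?e * t] (mod int r)"
    if "\<sigma> permutes {..<2}" "int p dvd y 0 + y 1" for \<sigma> y
    using z that in_center_iff [OF \<pi> x] unfolding n sum_less_2 by blast
  have "Transposition.transpose 0 1 permutes {..<2 :: nat}" by (intro permutes_swap_id) auto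
  from comm [OF this, of "\<lambda>_. 0"] obtain t
    where t: "int r dvd x 1 - x 0 - ?e * t" "int r dvd x 0 - x 1 - ?e * t"
    by (auto simp: all_less_2 cong_iff_dvd_diff algebra_simps)
  show "int r dvd 2 * (x 0 - x 1)"
    using dvd_diff [OF t(2,1)] by (simp add: algebra_simps)
  show "[x 0 = x 1] (mod int r)" if "odd q"
  proof -
    have "int r dvd 2 * (?e * t)"
    proof -
      have "2 * (?e * t) = - ((x 1 - x 0 - ?e * t) + (x 0 - x 1 - ?e * t))" by simp
      then show ?thesis by (simp only: dvd_minus_iff dvd_add [OF t])
    qed
    from dvd_add [OF t(2) twice_coset_step [OF that this]] show ?thesis
      by (simp add: cong_iff_dvd_diff)
  qed
  show "\<pi> = id"
  proof (rule ccontr)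
    assume "\<pi> \<noteq> id"
    then have \<pi>_eq: "\<pi> = Transposition.transpose 0 1" using \<pi> permutes_lessThan_2 n by blast
    have swap: "\<exists>t. int r dvd y 0 - y 1 - ?e * t \<and> int r dvd y 1 - y 0 - ?e * t"
      if "int p dvd y 0 + y 1" for y :: "nat \<Rightarrow> int"
      using comm [OF permutes_id that]
      by (auto simp: \<pi>_eq all_less_2 cong_iff_dvd_diff algebra_simps)
    show False
    proof (cases "odd q")
      case True
      \<comment> \<open>The diagonal with exponents 1 and -1 has sum 0, so it is available for every
        \<open>p\<close>; it would force \<open>r\<close> to divide 2.\<close>
      obtain t where t: "int r dvd 2 - ?e * t" "int r dvd - 2 - ?e * t"
        using swap [of "\<lambda>j. if j = 0 then 1 else - 1"] by auto
      have "int r dvd 2 * (?e * t)"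
      proof -
        have "2 * (?e * t) = - ((2 - ?e * t) + (- 2 - ?e * t))" by simp
        then show ?thesis by (simp only: dvd_minus_iff dvd_add [OF t])
      qed
      from twice_coset_step [OF True this] have "int r dvd 2"
        using t(1) by (simp add: dvd_diff_left_iff)
      with r have "int 4 dvd 2" by (meson dvd_trans int_dvd_int_iff)
      then show False by simp
    next
      case False
      then have "odd p" using pq by blast
      \<comment> \<open>The exponents \<open>p\<close> and 0 are admissible for any \<open>q\<close>
        and force \<open>r\<close> to divide \<open>2 * p\<close>, which is not divisible by
        4.\<close>
      obtain t where t: "int r dvd int p - ?e * t" "int r dvd - int p - ?e * t"
        using swap [of "\<lambda>j. if j = 0 then int p else 0"] by auto
      have "int r dvd int (2 * p)" using dvd_diff [OF t] by simp
      with r have "4 dvd 2 * p" by (meson dvd_trans int_dvd_int_iff)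
      then show False using \<open>odd p\<close> by presburger
    qed
  qed
qed

lemma center_rank_2_odd_q:
  assumes n: "n = 2" and r: "4 dvd r" and q: "odd q"
  shows "center (G_rpqn r p q n) \<subseteq> scalars"
proof
  fix z assume z: "z \<in> center (G_rpqn r p q n)"
  then obtain \<pi> x where z_eq: "z = cls r q n \<pi> x" and \<pi>: "\<pi> permutes {..<n}"
    and x: "int p dvd (\<Sum>i<n. x i)" by (auto simp: center_def carrier_Q)
  have "\<pi> = id" and "[x 0 = x 1] (mod int r)"
    using center_rank_2 [OF n r _ \<pi> x] q z z_eq by auto
  then have cong: "[x j = x 1] (mod int r)" if "j < n" for j
    using that n by (auto simp: less_2_cases_iff)
  have "int p dvd int n * x 1"
    using x dvd_sum_cong [of "int p" "int r" n x "\<lambda>_. x 1"] cong p_dvd by simp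
  then show "z \<in> scalars"
    unfolding z_eq \<open>\<pi> = id\<close> scalars_def using cls_scalar_eq [of x "x 1"] cong by blast
qed

lemma dvd_half:
  assumes "even r" "odd m" "m dvd r"
  shows "m dvd r div 2"
proof -
  have "m dvd 2 * (r div 2)" using assms by simp
  moreover have "coprime m 2" using assms(2) by simp
  ultimately show ?thesis by (simp add: coprime_dvd_mult_right_iff)
qed

text \<open>\<open>x 0 - x 1\<close> is a multiple of \<open>r / 2\<close>, hence congruent to 0 or
  to \<open>r / 2\<close>. The second case is a scalar times \<open>diag(-1, 1)\<close>, which lies
  in G(r,p,2) because the odd number \<open>p\<close> divides \<open>r / 2\<close>.\<close>

lemma center_rank_2_odd_p:
  assumes n: "n = 2" and r: "4 dvd r" and p: "odd p"
  shows "center (G_rpqn r p q n) \<subseteq> scalars \<union>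
    (\<lambda>z. cls r q n id (\<lambda>j. if j = 0 then int (r div 2) else 0) \<otimes>\<^bsub>G_rpqn r p q n\<^esub> z) ` scalars"
proof
  let ?h = "\<lambda>j :: nat. if j = 0 then int (r div 2) else 0"
  fix z assume z: "z \<in> center (G_rpqn r p q n)"
  then obtain \<pi> x where z_eq: "z = cls r q n \<pi> x" and \<pi>: "\<pi> permutes {..<n}"
    and x: "int p dvd (\<Sum>i<n. x i)" by (auto simp: center_def carrier_Q)
  have "\<pi> = id" and dvd: "int r dvd 2 * (x 0 - x 1)"
    using center_rank_2 [OF n r _ \<pi> x] p z z_eq by auto
  have "even r" using r by (rule dvd_trans [rotated]) simp
  then have r2: "int r = 2 * int (r div 2)" by (rule int_half)
  have p2: "int p dvd int (r div 2)"
    using dvd_half [OF \<open>even r\<close> p p_dvd] by (simp only: int_dvd_int_iff)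
  show "z \<in> scalars \<union> (\<lambda>z. cls r q n id ?h \<otimes>\<^bsub>G_rpqn r p q n\<^esub> z) ` scalars"
  proof (cases "[x 0 = x 1] (mod int r)")
    case True
    then have cong: "[x j = x 1] (mod int r)" if "j < n" for j
      using that n by (auto simp: less_2_cases_iff)
    have "int p dvd int n * x 1"
      using x dvd_sum_cong [of "int p" "int r" n x "\<lambda>_. x 1"] cong p_dvd by simp
    then have "z \<in> scalars"
      unfolding z_eq \<open>\<pi> = id\<close> scalars_def using cls_scalar_eq [of x "x 1"] cong by blast
    then show ?thesis ..
  next
    case False
    have "2 * int (r div 2) dvd 2 * (x 0 - x 1)" using dvd by (simp only: r2 [symmetric])
    then have "int (r div 2) dvd x 0 - x 1" unfolding dvd_mult_cancel_left by simp
    then obtain k where k: "x 0 - x 1 = int (r div 2) * k" by blast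
    have "odd k"
    proof
      assume "even k"
      then obtain l where "k = 2 * l" by blast
      then have "x 0 - x 1 = int r * l" using k by (simp add: r2)
      then show False using False by (simp add: cong_iff_dvd_diff)
    qed
    then obtain l where "k = 2 * l + 1" by (auto elim: oddE)
    then have "x 0 - (int (r div 2) + x 1) = int r * l" using k by (simp add: r2 algebra_simps)
    then have "[x 0 = int (r div 2) + x 1] (mod int r)" by (simp add: cong_iff_dvd_diff)
    then have cong: "[x j = ?h j + x 1] (mod int r)" if "j < n" for j
      using that n by (auto simp: less_2_cases_iff)
    have "int p dvd (\<Sum>j<n. ?h j + x 1)"
      using x dvd_sum_cong [of "int p" "int r" n x "\<lambda>j. ?h j + x 1"] cong p_dvd by simp
    then have "int p dvd int (r div 2) + int n * x 1" by (simp add: n sum_less_2 ac_simps)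
    then have px: "int p dvd int n * x 1" using p2 by (simp add: dvd_add_right_iff)
    have "z = cls r q n id (\<lambda>j. ?h j + x 1)"
    proof -
      have "\<forall>j<n. [x j = ?h j + x 1 + int (r div q) * 0] (mod int r)" using cong by simp
      then show ?thesis
        unfolding z_eq \<open>\<pi> = id\<close> cls_eq_iff [OF r_pos permutes_id permutes_id] by blast
    qed
    also have "\<dots> = cls r q n id ?h \<otimes>\<^bsub>G_rpqn r p q n\<^esub> cls r q n id (\<lambda>_. x 1)"
      using px p2 by (subst mult_Q) (auto simp: n permutes_id sum_less_2)
    finally show ?thesis using px by (auto simp: scalars_def)
  qed
qed

lemma card_scalars_rank_2: "n = 2 \<Longrightarrow> p * q * card scalars = r * gcd p 2"
  using card_scalar_classes by simp

lemma finite_center: "finite (center (G_rpqn r p q n))"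
  using finite_Q by (rule rev_finite_subset) (auto simp: center_def)

lemma finite_scalars: "finite scalars"
  using finite_center scalars_subset_center by (rule rev_finite_subset)

text \<open>For odd \<open>q\<close> the centre is scalar and \<open>gcd p 2\<close> is at most 2.
  For odd \<open>p\<close> the scalars contribute only \<open>r\<close>, but there may be a second
  coset of them. Both cases end at \<open>2 * r\<close>.\<close>

lemma card_center_rank_2_le:
  assumes n: "n = 2" and r: "4 dvd r" and pq: "odd p \<or> odd q"
  shows "p * q * card (center (G_rpqn r p q n)) \<le> 2 * r"
proof (cases "odd q")
  case True
  have "p * q * card (center (G_rpqn r p q n)) \<le> p * q * card scalars"
    using card_mono [OF finite_scalars center_rank_2_odd_q [OF n r True]] by simp
  also have "\<dots> \<le> r * 2" unfolding card_scalars_rank_2 [OF n] by (intro mult_left_mono gcd_le2_nat) auto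
  finally show ?thesis by simp
next
  case False
  then have "odd p" using pq by blast
  let ?f = "\<lambda>z. cls r q n id (\<lambda>j. if j = 0 then int (r div 2) else 0) \<otimes>\<^bsub>G_rpqn r p q n\<^esub> z"
  have "card (center (G_rpqn r p q n)) \<le> card (scalars \<union> ?f ` scalars)"
    using center_rank_2_odd_p [OF n r \<open>odd p\<close>] finite_scalars by (intro card_mono) auto
  also have "\<dots> \<le> card scalars + card (?f ` scalars)" by (rule card_Un_le)
  also have "\<dots> \<le> card scalars + card scalars"
    using card_image_le [OF finite_scalars] by simp
  finally have "p * q * card (center (G_rpqn r p q n)) \<le> 2 * (p * q * card scalars)"
    using mult_le_mono2 by fastforce
  also have "p * q * card scalars = r"
    unfolding card_scalars_rank_2 [OF n] using \<open>odd p\<close>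
    by (metis coprime_iff_gcd_eq_1 coprime_right_2_iff_odd mult.right_neutral)
  finally show ?thesis .
qed

text \<open>Swapping the two diagonal entries multiplies such a matrix by the scalar -1, which is
  trivial in the quotient when \<open>q\<close> is even.\<close>

lemma antisymmetric_in_center:
  assumes n: "n = 2" and q: "even q" and d: "[x 0 - x 1 = int (r div 2)] (mod int r)"
    and x: "int p dvd x 0 + x 1"
  shows "cls r q n id x \<in> center (G_rpqn r p q n)"
proof -
  have "int r = int (r div q) * int q" by (simp add: r_div_q)
  have "even r" using q q_dvd by (rule dvd_trans)
  then have r2: "int r = 2 * int (r div 2)" by (rule int_half)
  have h: "int (r div q) * int (q div 2) = int (r div 2)"
  proof -
    have "2 * (int (r div q) * int (q div 2)) = int r"
      using q r_div_q by (metis (no_types, opaque_lifting) dvd_mult_div_cancel mult.left_commute of_nat_mult of_nat_numeral)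
    then show ?thesis using r2 by simp
  qed
  have d': "int r dvd x 0 - x 1 - int (r div 2)" using d by (simp add: cong_iff_dvd_diff)
  have d'': "int r dvd x 1 - x 0 - int (r div 2)"
  proof -
    have "x 1 - x 0 - int (r div 2) = - (x 0 - x 1 - int (r div 2)) - int r" using r2 by simp
    then show ?thesis using d' by (simp only: dvd_diff dvd_minus_iff dvd_refl)
  qed
  have "\<exists>t. \<forall>j<n. [x (\<sigma> j) + y j = y (id j) + x j + int (r div q) * t] (mod int r)"
    if \<sigma>: "\<sigma> permutes {..<n}" for \<sigma> y
  proof -
    consider "\<sigma> = id" | "\<sigma> = Transposition.transpose 0 1" using \<sigma> permutes_lessThan_2 n by blast
    then show ?thesis
    proof cases
      case 1
      then show ?thesis by (auto simp: add.commute intro!: exI [of _ 0])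
    next
      case 2
      \<comment> \<open>The parameter \<open>q div 2\<close> of \<open>C_q\<close> gives the shift
        \<open>r div 2\<close>, that is, the scalar -1.\<close>
      have "\<forall>j<n. [x (\<sigma> j) + y j = y (id j) + x j + int (r div q) * int (q div 2)] (mod int r)"
        using d' d'' unfolding 2 n all_less_2 h cong_iff_dvd_diff by (simp add: algebra_simps)
      then show ?thesis by blast
    qed
  qed
  then show ?thesis
    using x by (subst in_center_iff) (auto simp: permutes_id n sum_less_2)
qed

text \<open>An element of \<open>C_q\<close> shifts both exponents equally, so the difference of the
  exponents is an invariant of the class; it is 0 for scalars.\<close>

lemma antisymmetric_not_scalar:
  assumes n: "n = 2" and r: "even r" and d: "[x 0 - x 1 = int (r div 2)] (mod int r)"
  shows "cls r q n id x \<notin> scalars"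
proof
  assume "cls r q n id x \<in> scalars"
  then obtain a where "cls r q n id x = cls r q n id (\<lambda>_. a)" by (auto simp: scalars_def)
  then obtain t where "\<And>j. j < n \<Longrightarrow> [x j = a + int (r div q) * t] (mod int r)"
    by (auto simp: cls_eq_iff r_pos permutes_id)
  from cong_diff [OF this [of 0] this [of 1]] have "[x 0 - x 1 = 0] (mod int r)" by (simp add: n)
  with d have "[int (r div 2) = 0] (mod int r)" by (meson cong_sym cong_trans)
  then have "r dvd r div 2" by (simp only: cong_0_iff int_dvd_int_iff)
  then have "r \<le> r div 2" using r r_pos by (intro dvd_imp_le) auto
  then show False using r_pos by simp
qed

lemma card_center_rank_2_gt:
  assumes n: "n = 2" and r: "4 dvd r" and p: "even p" and q: "even q"
  shows "p * q * card (center (G_rpqn r p q n)) > 2 * r"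
proof -
  \<comment> \<open>This is \<open>diag(i, -i)\<close>: the exponents differ by
    \<open>r / 2\<close>, and their sum 0 meets the condition for every \<open>p\<close>.\<close>
  let ?x = "\<lambda>j :: nat. if j = 0 then int (r div 4) else - int (r div 4)"
  have "int (r div 2) = 2 * int (r div 4)" using r by (auto elim!: dvdE)
  then have d: "[?x 0 - ?x 1 = int (r div 2)] (mod int r)" by simp
  have "cls r q n id ?x \<notin> scalars"
    using antisymmetric_not_scalar [OF n _ d] q q_dvd dvd_trans by blast
  then have "card scalars < card (insert (cls r q n id ?x) scalars)"
    using finite_scalars by simp
  also have "\<dots> \<le> card (center (G_rpqn r p q n))"
    using antisymmetric_in_center [OF n q d] scalars_subset_center finite_center
    by (intro card_mono) auto
  finally have "p * q * card scalars < p * q * card (center (G_rpqn r p q n))"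
    using p_pos q_pos by simp
  moreover have "p * q * card scalars = 2 * r"
    unfolding card_scalars_rank_2 [OF n] using p gcd_nat.absorb2 by simp
  ultimately show ?thesis by simp
qed

text \<open>The identity class is included, so the counts below are those of the elements of order
  at most 2.\<close>

abbreviation "central_involutions \<equiv>
  {z \<in> center (G_rpqn r p q n). z \<otimes>\<^bsub>G_rpqn r p q n\<^esub> z = \<one>\<^bsub>G_rpqn r p q n\<^esub>}"

lemma finite_central_involutions: "finite central_involutions"
  using finite_center by simp

text \<open>Three classes are exhibited: the identity, \<open>diag(-1, 1)\<close>, and the scalar
  with exponent \<open>p * k\<close>. The latter is half of the step
  \<open>r div q = 2 * (p * k)\<close>, so its square lies in \<open>C_q\<close> while it does not;
  the factor 2 in \<open>2 * (p * q) dvd r\<close> is what makes this half a multiple of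
  \<open>p\<close>.\<close>

lemma card_central_involutions_ge:
  assumes n: "n = 2" and p: "odd p" and q: "even q" and pq: "2 * (p * q) dvd r"
  shows "card central_involutions \<ge> 3"
proof -
  have "even r" using q q_dvd by (rule dvd_trans)
  then have r2: "int r = 2 * int (r div 2)" by (rule int_half)
  obtain k where k: "r = 2 * (p * q) * k" using pq by blast
  then have e: "r div q = 2 * (p * k)" using q_pos by simp
  have "k > 0" using k r_pos by (auto intro: Nat.gr0I)
  let ?x = "\<lambda>j :: nat. if j = 0 then int (r div 2) else 0"
  let ?t = "cls r q n id ?x" and ?z = "cls r q n id (\<lambda>_. int (p * k))"
    and ?o = "cls r q n id (\<lambda>_. 0)"
  have p2: "int p dvd int (r div 2)"
    using dvd_half [OF \<open>even r\<close> p p_dvd] by (simp only: int_dvd_int_iff)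
  have t: "?t \<in> center (G_rpqn r p q n)"
    using p2 by (intro antisymmetric_in_center n q) auto
  have "?t \<otimes>\<^bsub>G_rpqn r p q n\<^esub> ?t = cls r q n id (\<lambda>j. ?x j + ?x j)"
    using p2 by (subst mult_Q) (auto simp: permutes_id n sum_less_2)
  also have "\<dots> = ?o"
    using r2 by (subst cls_scalar_eq [of _ 0]) (auto simp: cong_0_iff)
  finally have t2: "?t \<otimes>\<^bsub>G_rpqn r p q n\<^esub> ?t = \<one>\<^bsub>G_rpqn r p q n\<^esub>" by (simp add: one_Q)
  have z: "?z \<in> scalars" by (auto simp: scalars_def)
  have "?z \<otimes>\<^bsub>G_rpqn r p q n\<^esub> ?z = cls r q n id (\<lambda>j. int (p * k) + int (p * k))"
    by (subst mult_Q) (auto simp: permutes_id)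
  also have "\<dots> = ?o"
    unfolding cls_eq_iff [OF r_pos permutes_id permutes_id] by (auto simp: e mult.commute intro!: exI [of _ 1])
  finally have z2: "?z \<otimes>\<^bsub>G_rpqn r p q n\<^esub> ?z = \<one>\<^bsub>G_rpqn r p q n\<^esub>" by (simp add: one_Q)
  have o: "?o \<in> scalars" by (auto simp: scalars_def)
  have o2: "?o \<otimes>\<^bsub>G_rpqn r p q n\<^esub> ?o = \<one>\<^bsub>G_rpqn r p q n\<^esub>"
    using group.is_monoid [OF group_Q] by (simp flip: one_Q add: monoid.l_one monoid.one_closed)
  have "?t \<notin> scalars" using \<open>even r\<close> by (intro antisymmetric_not_scalar n) auto
  moreover have "?z \<noteq> ?o"
  proof
    assume "?z = ?o"
    then obtain s where "[int (p * k) = int (r div q) * s] (mod int r)"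
      using n_pos by (auto simp: cls_eq_iff r_pos permutes_id)
    moreover have "int (r div q) dvd int r" using r_div_q_dvd by (simp only: int_dvd_int_iff)
    ultimately have "[int (p * k) = int (r div q) * s] (mod int (r div q))"
      by (rule cong_dvd_modulus)
    then have "int (r div q) dvd int (p * k)"
      by (metis cong_dvd_iff dvd_refl dvd_triv_left)
    then have "2 * (p * k) dvd p * k" unfolding e by (simp only: int_dvd_int_iff)
    then have "2 * (p * k) \<le> p * k" using p_pos \<open>k > 0\<close> by (intro dvd_imp_le) auto
    then show False using p_pos \<open>k > 0\<close> by simp
  qed
  ultimately have "card {?t, ?z, ?o} = 3" using z o by (metis card_3_iff)
  moreover have "{?t, ?z, ?o} \<subseteq> central_involutions"
    using t t2 z z2 o o2 scalars_subset_center by blast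
  then have "card {?t, ?z, ?o} \<le> card central_involutions"
    by (rule card_mono [OF finite_central_involutions])
  ultimately show ?thesis by linarith
qed

text \<open>The centre is scalar here. Since 4 divides \<open>r\<close> and \<open>q\<close> is odd,
  the step \<open>r div q\<close> is even, and a scalar whose square lies in \<open>C_q\<close> has
  an exponent divisible by half the step; modulo the step two values remain.\<close>

lemma card_central_involutions_le:
  assumes n: "n = 2" and r: "4 dvd r" and q: "odd q"
  shows "card central_involutions \<le> 2"
proof -
  let ?h = "r div q div 2"
  have "even (r div q * q)" using r q_dvd by (auto elim: dvd_trans [rotated])
  then have "even (r div q)" using q by simp
  then have h: "int (r div q) = 2 * int ?h" by (rule int_half)
  have "central_involutions \<subseteq> {cls r q n id (\<lambda>_. 0), cls r q n id (\<lambda>_. int ?h)}"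
  proof
    fix z assume z: "z \<in> central_involutions"
    then obtain a where z_eq: "z = cls r q n id (\<lambda>_. a)" and a: "int p dvd int n * a"
      using center_rank_2_odd_q [OF n r q] by (auto simp: scalars_def)
    have "z \<otimes>\<^bsub>G_rpqn r p q n\<^esub> z = cls r q n id (\<lambda>_. a + a)"
      unfolding z_eq using a by (subst mult_Q) (auto simp: permutes_id)
    with z have "cls r q n id (\<lambda>_. a + a) = cls r q n id (\<lambda>_. 0)" by (simp add: one_Q)
    then obtain t where "[a + a = int (r div q) * t] (mod int r)"
      using n_pos by (auto simp: cls_eq_iff r_pos permutes_id)
    moreover have "int (r div q) dvd int r" using r_div_q_dvd by (simp only: int_dvd_int_iff)
    ultimately have "[a + a = int (r div q) * t] (mod int (r div q))"
      by (rule cong_dvd_modulus)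
    then have "int (r div q) dvd a + a" by (metis cong_dvd_iff dvd_refl dvd_triv_left)
    then have "2 * int ?h dvd 2 * a" unfolding h by simp
    then obtain k where k: "a = int ?h * k" by auto
    show "z \<in> {cls r q n id (\<lambda>_. 0), cls r q n id (\<lambda>_. int ?h)}"
    proof (cases "even k")
      case True
      then obtain l where "k = 2 * l" by blast
      then have "a = 0 + int (r div q) * l" by (simp add: k h)
      then have "z = cls r q n id (\<lambda>_. 0)"
        unfolding z_eq cls_eq_iff [OF r_pos permutes_id permutes_id] by (auto intro!: exI [of _ l])
      then show ?thesis by simp
    next
      case False
      then obtain l where "k = 2 * l + 1" by (auto elim: oddE)
      then have "a = int ?h + int (r div q) * l" by (simp add: k h algebra_simps)
      then have "z = cls r q n id (\<lambda>_. int ?h)"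
        unfolding z_eq cls_eq_iff [OF r_pos permutes_id permutes_id] by (auto intro!: exI [of _ l])
      then show ?thesis by simp
    qed
  qed
  from card_mono [OF _ this] have "card central_involutions \<le> card {cls r q n id (\<lambda>_. 0), cls r q n id (\<lambda>_. int ?h)}"
    by simp
  also have "\<dots> \<le> 2" by (simp add: card_insert_if)
  finally show ?thesis .
qed

end

section \<open>Homomorphisms induced by linear maps on exponents\<close>

text \<open>The two divisibilities make the map well defined. Changing the exponent sum by
  \<open>r\<close> changes the added term by \<open>J * r / p\<close>, a multiple of
  \<open>r / q'\<close> if \<open>p\<close> divides \<open>J * q'\<close>. If \<open>p'\<close>
  divides \<open>\<alpha> * p + J * n\<close>, then exponent sums divisible by \<open>p\<close>
  become divisible by \<open>p'\<close>, and \<open>C_q\<close> is carried into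
  \<open>C_q'\<close>.\<close>

locale coset_linear_map =
  P: projective_reflection_group r n p q + P': projective_reflection_group r n p' q'
  for r n p q p' q' :: nat +
  fixes \<alpha> J :: int
  assumes pq_eq: "p * q = p' * q'"
    and p_dvd_J: "int p dvd J * int q'"
    and p'_dvd: "int p' dvd \<alpha> * int p + J * int n"
begin

definition exponent_map :: "(nat \<Rightarrow> int) \<Rightarrow> nat \<Rightarrow> int" where
  "exponent_map x j = \<alpha> * x j + J * ((\<Sum>i<n. x i) div int p)"

text \<open>As \<open>p * q = p' * q'\<close>, both sides equal
  \<open>r * p * p' / (p * q)\<close>.\<close>

lemma step_relation: "int (r div q) * int p' = int (r div q') * int p"
proof -
  have "int (r div q) * int p' * int q' = int (r div q) * int q * int p"
    using pq_eq by (simp add: mult.assoc mult.commute flip: of_nat_mult)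
  also have "\<dots> = int (r div q') * int p * int q'"
    using P.r_div_q P'.r_div_q by (metis mult.assoc mult.commute)
  finally show ?thesis using P'.q_pos by simp
qed

lemma sum_exponent_map:
  assumes "int p dvd (\<Sum>i<n. x i)"
  shows "int p' dvd (\<Sum>i<n. exponent_map x i)"
proof -
  obtain k where k: "(\<Sum>i<n. x i) = int p * k" using assms by blast
  have "(\<Sum>i<n. exponent_map x i) = (\<alpha> * int p + J * int n) * k"
    using P.p_pos k by (simp add: exponent_map_def sum.distrib flip: sum_distrib_left) (simp add: algebra_simps)
  then show ?thesis using p'_dvd by simp
qed

lemma exponent_map_add:
  assumes "\<sigma> permutes {..<n}" "int p dvd (\<Sum>i<n. x i)"
  shows "exponent_map (\<lambda>j. x (\<sigma> j) + y j) = (\<lambda>j. exponent_map x (\<sigma> j) + exponent_map y j)"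
  using assms(2) by (simp add: exponent_map_def sum.distrib sum_permutes [OF assms(1), of x] fun_eq_iff
    div_plus_div_distrib_dvd_left algebra_simps)

lemma exponent_map_cong:
  assumes x: "int p dvd (\<Sum>i<n. x i)" and y: "int p dvd (\<Sum>i<n. y i)"
    and cong: "\<And>j. j < n \<Longrightarrow> [x j = y j + int (r div q) * t] (mod int r)"
  shows "\<exists>t. \<forall>j<n. [exponent_map x j = exponent_map y j + int (r div q') * t] (mod int r)"
proof -
  let ?e = "int (r div q)" and ?e' = "int (r div q')"
  obtain k where k: "(\<Sum>i<n. x i) = int p * k" using x by blast
  obtain l where l: "(\<Sum>i<n. y i) = int p * l" using y by blast
  obtain v where v: "\<alpha> * int p + J * int n = int p' * v" using p'_dvd by blast
  obtain w where w: "J * int q' = int p * w" using p_dvd_J by blast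
  have "[(\<Sum>i<n. x i) = (\<Sum>i<n. y i + ?e * t)] (mod int r)" using cong by (intro cong_sum) auto
  then have "int r dvd int p * k - (int p * l + int n * (?e * t))"
    by (simp add: cong_iff_dvd_diff sum.distrib k l)
  then obtain s where s: "int p * k - (int p * l + int n * (?e * t)) = int r * s" by blast
  \<comment> \<open>The identity is proved after multiplication by \<open>p\<close>, where the exact
    quotients \<open>k\<close> and \<open>l\<close> become sums again; \<open>v\<close> accounts for
    the shift by \<open>C_q\<close> and \<open>w\<close> for the reduction modulo
    \<open>r\<close>.\<close>
  have "int p * (\<alpha> * (?e * t) + J * (k - l))
      = \<alpha> * int p * (?e * t) + J * (int p * k - int p * l)" by (simp add: algebra_simps)
  also have "\<dots> = \<alpha> * int p * (?e * t) + J * (int n * (?e * t) + int r * s)"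
    using s by (simp add: algebra_simps)
  also have "\<dots> = (\<alpha> * int p + J * int n) * (?e * t) + (J * int q') * ?e' * s"
    by (simp add: algebra_simps flip: P'.r_div_q)
  also have "\<dots> = (?e * int p') * (v * t) + int p * w * ?e' * s"
    unfolding v w by (simp only: ac_simps)
  also have "\<dots> = int p * (?e' * (v * t + w * s))"
    unfolding step_relation by (simp add: algebra_simps)
  finally have D: "\<alpha> * (?e * t) + J * (k - l) = ?e' * (v * t + w * s)"
    using P.p_pos by simp
  have "[exponent_map x j = exponent_map y j + ?e' * (v * t + w * s)] (mod int r)" if "j < n" for j
  proof -
    have "exponent_map x j - (exponent_map y j + ?e' * (v * t + w * s)) = \<alpha> * (x j - (y j + ?e * t))"
      unfolding D [symmetric] using P.p_pos k l by (simp add: exponent_map_def algebra_simps)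
    then show ?thesis
      using cong [OF that] by (simp add: cong_iff_dvd_diff)
  qed
  then show ?thesis by blast
qed

text \<open>A choice over all representatives of the class; \<open>exponent_map_cong\<close> makes
  the result independent of it.\<close>

definition induced_map :: "complex mat set \<Rightarrow> complex mat set" where
  "induced_map X = (SOME Y. \<exists>\<pi> x. \<pi> permutes {..<n} \<and> int p dvd (\<Sum>i<n. x i) \<and>
    X = cls r q n \<pi> x \<and> Y = cls r q' n \<pi> (exponent_map x))"

lemma induced_map_cls:
  assumes "\<pi> permutes {..<n}" "int p dvd (\<Sum>i<n. x i)"
  shows "induced_map (cls r q n \<pi> x) = cls r q' n \<pi> (exponent_map x)"
  unfolding induced_map_def
proof (rule some_equality)
  show "\<exists>\<pi>' x'. \<pi>' permutes {..<n} \<and> int p dvd (\<Sum>i<n. x' i) \<and>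
      cls r q n \<pi> x = cls r q n \<pi>' x' \<and> cls r q' n \<pi> (exponent_map x) = cls r q' n \<pi>' (exponent_map x')"
    using assms by blast
next
  fix Y assume "\<exists>\<pi>' x'. \<pi>' permutes {..<n} \<and> int p dvd (\<Sum>i<n. x' i) \<and>
      cls r q n \<pi> x = cls r q n \<pi>' x' \<and> Y = cls r q' n \<pi>' (exponent_map x')"
  then obtain \<pi>' x' where *: "\<pi>' permutes {..<n}" "int p dvd (\<Sum>i<n. x' i)"
    "cls r q n \<pi> x = cls r q n \<pi>' x'" and Y: "Y = cls r q' n \<pi>' (exponent_map x')" by blast
  then obtain t where "\<pi> = \<pi>'" and t: "\<And>j. j < n \<Longrightarrow> [x j = x' j + int (r div q) * t] (mod int r)"
    using assms by (auto simp: cls_eq_iff P.r_pos)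
  with exponent_map_cong [OF assms(2) *(2) t] have "cls r q' n \<pi> (exponent_map x) = cls r q' n \<pi>' (exponent_map x')"
    using assms(1) by (simp add: cls_eq_iff P.r_pos)
  then show "Y = cls r q' n \<pi> (exponent_map x)" using Y by simp
qed

lemma induced_map_hom: "induced_map \<in> hom (G_rpqn r p q n) (G_rpqn r p' q' n)"
proof (rule homI)
  fix X assume "X \<in> carrier (G_rpqn r p q n)"
  then show "induced_map X \<in> carrier (G_rpqn r p' q' n)"
    by (auto simp: P.carrier_Q induced_map_cls intro!: P'.cls_in_Q sum_exponent_map)
next
  fix X Y assume "X \<in> carrier (G_rpqn r p q n)" "Y \<in> carrier (G_rpqn r p q n)"
  then obtain \<pi> x \<sigma> y where X: "X = cls r q n \<pi> x" "\<pi> permutes {..<n}" "int p dvd (\<Sum>i<n. x i)"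
    and Y: "Y = cls r q n \<sigma> y" "\<sigma> permutes {..<n}" "int p dvd (\<Sum>i<n. y i)"
    unfolding P.carrier_Q by blast
  have "induced_map (X \<otimes>\<^bsub>G_rpqn r p q n\<^esub> Y) = induced_map (cls r q n (\<pi> \<circ> \<sigma>) (\<lambda>j. x (\<sigma> j) + y j))"
    using X Y by (simp add: P.mult_Q)
  also have "\<dots> = cls r q' n (\<pi> \<circ> \<sigma>) (exponent_map (\<lambda>j. x (\<sigma> j) + y j))"
    using X Y by (intro induced_map_cls permutes_compose) (simp_all add: sum.distrib sum_permutes [OF Y(2), of x])
  also have "\<dots> = cls r q' n (\<pi> \<circ> \<sigma>) (\<lambda>j. exponent_map x (\<sigma> j) + exponent_map y j)"
    using X Y by (simp add: exponent_map_add)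
  also have "\<dots> = induced_map X \<otimes>\<^bsub>G_rpqn r p' q' n\<^esub> induced_map Y"
    using X Y by (simp add: induced_map_cls P'.mult_Q sum_exponent_map)
  finally show "induced_map (X \<otimes>\<^bsub>G_rpqn r p q n\<^esub> Y) = induced_map X \<otimes>\<^bsub>G_rpqn r p' q' n\<^esub> induced_map Y" .
qed

lemma card_Q_eq: "card (carrier (G_rpqn r p q n)) = card (carrier (G_rpqn r p' q' n))"
proof -
  have "p * q * card (carrier (G_rpqn r p q n)) = p * q * card (carrier (G_rpqn r p' q' n))"
    using P.card_Q P'.card_Q pq_eq by simp
  then show ?thesis using P.p_pos P.q_pos by simp
qed

text \<open>The permutation is preserved, so the kernel consists of diagonal classes and the premise
  says that it is trivial. The two groups are finite of the same order, hence injectivity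
  suffices.\<close>

lemma iso_if_injective:
  assumes "\<And>x t. int p dvd (\<Sum>i<n. x i) \<Longrightarrow> (\<And>j. j < n \<Longrightarrow> [exponent_map x j = int (r div q') * t] (mod int r)) \<Longrightarrow>
    \<exists>s. \<forall>j<n. [x j = int (r div q) * s] (mod int r)"
  shows "G_rpqn r p q n \<cong> G_rpqn r p' q' n"
proof -
  have "inj_on induced_map (carrier (G_rpqn r p q n))"
  proof (subst inj_on_one_iff' [OF induced_map_hom P.group_Q P'.group_Q], intro allI impI)
    fix X assume "X \<in> carrier (G_rpqn r p q n)" and F: "induced_map X = \<one>\<^bsub>G_rpqn r p' q' n\<^esub>"
    then obtain \<pi> x where X: "X = cls r q n \<pi> x" "\<pi> permutes {..<n}" "int p dvd (\<Sum>i<n. x i)"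
      unfolding P.carrier_Q by blast
    then have "cls r q' n \<pi> (exponent_map x) = cls r q' n id (\<lambda>_. 0)" using F by (simp add: induced_map_cls P'.one_Q)
    then obtain t where "\<pi> = id" "\<And>j. j < n \<Longrightarrow> [exponent_map x j = int (r div q') * t] (mod int r)"
      using X(2) by (auto simp: cls_eq_iff P.r_pos permutes_id)
    then show "X = \<one>\<^bsub>G_rpqn r p q n\<^esub>"
      using assms [OF X(3)] by (auto simp: P.one_Q X(1) cls_eq_iff P.r_pos permutes_id)
  qed
  moreover from card_image [OF this] have "induced_map ` carrier (G_rpqn r p q n) = carrier (G_rpqn r p' q' n)"
    using induced_map_hom card_Q_eq by (intro card_subset_eq P'.finite_Q) (auto simp: hom_def)
  ultimately show ?thesis
    using induced_map_hom by (intro is_isoI [of induced_map]) (simp add: Group.iso_iff)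
qed

end

section \<open>Arithmetic of the shift \<open>J\<close>\<close>

lemma coprime_part_exists:
  fixes d m :: nat
  assumes "m > 0"
  shows "\<exists>m1 m2 N. m = m1 * m2 \<and> m1 dvd d ^ N \<and> coprime m2 d"
  using assms
proof (induction m rule: less_induct)
  case (less m)
  show ?case
  proof (cases "coprime m d")
    case True
    then have "m = 1 * m \<and> 1 dvd d ^ 0 \<and> coprime m d" by simp
    then show ?thesis by blast
  next
    case False
    define g where "g = gcd m d"
    have "g \<noteq> 1" using False by (simp add: g_def coprime_iff_gcd_eq_1)
    obtain m' where m': "m = g * m'" unfolding g_def by (meson dvdE gcd_dvd1)
    have "g > 1" "m' > 0" using less.prems m' \<open>g \<noteq> 1\<close> by (auto intro: Nat.gr0I)
    then have "m' < m" by (simp add: m')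
    from less.IH [OF this \<open>m' > 0\<close>] obtain m1 m2 N
      where *: "m' = m1 * m2" "m1 dvd d ^ N" "coprime m2 d" by blast
    have "g * m1 dvd d * d ^ N" using * by (intro mult_dvd_mono) (simp_all add: g_def)
    then have "m = (g * m1) * m2 \<and> g * m1 dvd d ^ Suc N \<and> coprime m2 d"
      using * m' by (simp add: mult.assoc)
    then show ?thesis by blast
  qed
qed

text \<open>\<open>gcd (x * d) n\<close> depends on \<open>x\<close> only through
  \<open>gcd x n\<close>, so a factor \<open>d\<close> absorbed once is absorbed every time.\<close>

lemma gcd_mult_power_absorb:
  fixes a d n :: nat
  assumes "gcd (a * d) n = gcd a n"
  shows "gcd (a * d ^ N) n = gcd a n"
proof (induction N)
  case (Suc N)
  have key: "gcd (x * d) n = gcd (gcd x n * d) n" for x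
  proof -
    have "gcd x n * d = gcd (x * d) (n * d)"
      using gcd_mult_distrib_nat [of d x n] by (simp only: mult.commute)
    then have "gcd (gcd x n * d) n = gcd (x * d) (gcd (n * d) n)" by (simp only: gcd.assoc)
    then show ?thesis by simp
  qed
  have "gcd (a * d ^ Suc N) n = gcd (a * d ^ N * d) n" by (simp add: ac_simps)
  also have "\<dots> = gcd (gcd a n * d) n" unfolding key [of "a * d ^ N"] Suc ..
  also have "\<dots> = gcd a n" unfolding key [symmetric] by (rule assms)
  finally show ?case .
qed simp

text \<open>Here \<open>n1\<close> and \<open>r1\<close> are the parts of \<open>n\<close> and
  \<open>r\<close> built from primes of \<open>d\<close>. By the gcd hypotheses \<open>n1\<close>
  divides \<open>p\<close> and \<open>q\<close>. The number \<open>u = d + r2 * n2\<close> is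
  coprime to \<open>d\<close> because \<open>r2 * n2\<close> is, and to \<open>r2\<close> because
  \<open>d\<close> is.\<close>

lemma shift_exists:
  fixes p q d n r :: nat
  assumes "n > 0" "r > 0" "p > 0"
    and "gcd (p * d) n = gcd p n" "gcd (q * d) n = gcd q n"
  shows "\<exists>J u. p dvd J * q \<and> p * d + J * n = p * u \<and> coprime u r"
proof -
  obtain n1 n2 N where n: "n = n1 * n2" "n1 dvd d ^ N" "coprime n2 d"
    using coprime_part_exists [OF assms(1)] by blast
  obtain r1 r2 M where r: "r = r1 * r2" "r1 dvd d ^ M" "coprime r2 d"
    using coprime_part_exists [OF assms(2)] by blast
  have n1_dvd: "n1 dvd a" if "gcd (a * d) n = gcd a n" for a
  proof -
    have "n1 dvd gcd (a * d ^ N) n" using n by simp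
    then show ?thesis using gcd_mult_power_absorb [OF that] by simp
  qed
  obtain k where k: "p = n1 * k" using n1_dvd [OF assms(4)] by blast
  obtain l where l: "q = n1 * l" using n1_dvd [OF assms(5)] by blast
  \<comment> \<open>The choice is \<open>J = k * r2\<close>: the factor \<open>k\<close> lets
    \<open>p\<close> be pulled out of \<open>J * n\<close>, and \<open>r2\<close> secures
    coprimality with the rest of \<open>r\<close>.\<close>
  have "p dvd (k * r2) * q" by (simp add: k l)
  moreover have "p * d + (k * r2) * n = p * (d + r2 * n2)"
    by (simp add: k n(1) algebra_simps)
  moreover have "coprime (d + r2 * n2) r"
  proof -
    have "gcd (r2 * n2) d = 1" using n r by simp
    then have "coprime (r2 * n2 + d) d" by (simp add: coprime_iff_gcd_eq_1)
    then have "coprime (d + r2 * n2) (d ^ M)" by (simp add: add.commute)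
    then have "coprime (d + r2 * n2) r1" using coprime_divisors [OF dvd_refl r(2)] by blast
    moreover have "coprime (d + r2 * n2) r2"
    proof -
      have "coprime r2 (n2 * r2 + d)" using r(3) unfolding coprime_iff_gcd_eq_1 gcd_add_mult .
      then show ?thesis by (simp add: coprime_commute mult.commute add.commute)
    qed
    ultimately show ?thesis by (simp add: r(1))
  qed
  ultimately show ?thesis by blast
qed

section \<open>The classification\<close>

text \<open>With \<alpha> = 1 the map adds the same number to all coordinates, so a kernel vector is
  constant, and only its value \<open>a\<close> has to be placed in the multiples of
  \<open>r div q\<close>.\<close>

lemma iso_transfer_factor:
  assumes P: "projective_reflection_group r n (p * d) q"
    and P': "projective_reflection_group r n p (q * d)"
    and gcd: "gcd (p * d) n = gcd p n" "gcd (q * d) n = gcd q n"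
  shows "G_rpqn r (p * d) q n \<cong> G_rpqn r p (q * d) n"
proof -
  interpret P: projective_reflection_group r n "p * d" q by (rule P)
  interpret P': projective_reflection_group r n p "q * d" by (rule P')
  have pos: "p > 0" "d > 0" using P.p_pos by auto
  obtain J u where J: "p dvd J * q" and u: "p * d + J * n = p * u" and "coprime u r"
    using shift_exists [OF P.n_pos P.r_pos \<open>p > 0\<close> gcd] by blast
  have intu: "int (p * d) + int J * int n = int p * int u"
    using u by (simp flip: of_nat_mult of_nat_add)
  interpret coset_linear_map r n "p * d" q p "q * d" 1 "int J"
  proof unfold_locales
    show "p * d * q = p * (q * d)" by simp
    have "p * d dvd J * q * d" using J by (intro mult_dvd_mono) simp_all
    then show "int (p * d) dvd int J * int (q * d)"
      by (simp add: mult.assoc flip: of_nat_mult)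
    show "int p dvd 1 * int (p * d) + int J * int n" using intu by simp
  qed
  let ?e = "int (r div q)" and ?e' = "int (r div (q * d))"
  show ?thesis
  proof (rule iso_if_injective)
    fix x t assume x: "int (p * d) dvd (\<Sum>i<n. x i)"
      and T: "\<And>j. j < n \<Longrightarrow> [exponent_map x j = ?e' * t] (mod int r)"
    obtain k where k: "(\<Sum>i<n. x i) = int (p * d) * k" using x by blast
    define a where "a = ?e' * t - int J * k"
    have a: "[x j = a] (mod int r)" if "j < n" for j
    proof -
      have "exponent_map x j = x j + int J * k" using pos k by (simp add: exponent_map_def)
      then show ?thesis using T [OF that] by (simp add: a_def cong_iff_dvd_diff algebra_simps)
    qed
    have "[(\<Sum>i<n. x i) = (\<Sum>i<n. a)] (mod int r)" using a by (intro cong_sum) auto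
    then have "int r dvd int (p * d) * k - int n * a" by (simp add: cong_iff_dvd_diff k)
    then obtain s where s: "int (p * d) * k = int n * a + int r * s"
      by (metis add.commute diff_add_cancel dvd_def)
    obtain w where w: "int J * int (q * d) = int (p * d) * w" using p_dvd_J by blast
    \<comment> \<open>As \<open>p * u = p * d + J * n\<close>, the term \<open>n * a\<close> can be
      exchanged for the exponent sum, which brings back the image \<open>?e' * t\<close>. The
      outcome is \<open>?e dvd a * u\<close>, and \<open>u\<close> is a unit modulo
      \<open>r\<close>.\<close>
    have "a * int p * int u = int (p * d) * a + int J * (int n * a)"
      by (simp add: mult.assoc flip: intu) (simp add: algebra_simps)
    also have "\<dots> = int (p * d) * a + int J * (int (p * d) * k) - int J * int r * s"
      unfolding s by (simp add: algebra_simps)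
    also have "\<dots> = int (p * d) * (?e' * t) - int J * int (q * d) * ?e' * s"
      unfolding a_def P'.r_div_q [symmetric] by (simp add: algebra_simps)
    also have "\<dots> = ?e' * int (p * d) * (t - w * s)"
      unfolding w by (simp add: algebra_simps)
    also have "\<dots> = ?e * int p * (t - w * s)" unfolding step_relation ..
    finally have "int p * (a * int u) = int p * (?e * (t - w * s))" by (simp only: ac_simps)
    then have "?e dvd a * int u" using pos by simp
    moreover have "coprime ?e (int u)"
      using coprime_divisors [OF P.r_div_q_dvd dvd_refl, of u] \<open>coprime u r\<close>
      by (simp add: coprime_commute)
    ultimately have "?e dvd a" by (simp add: coprime_dvd_mult_left_iff)
    then show "\<exists>s. \<forall>j<n. [x j = ?e * s] (mod int r)" using a by (auto elim!: dvdE)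
  qed
qed

text \<open>Multiply \<open>gcd p p'\<close> by \<open>q * q'\<close> and replace
  \<open>p' * q'\<close> by \<open>p * q\<close>: the result is
  \<open>p * q * gcd q q'\<close>.\<close>

lemma gcd_mult_lcm_cross:
  fixes p q p' q' :: nat
  assumes "p * q = p' * q'" "q > 0"
  shows "gcd p p' * lcm q q' = p * q"
proof -
  have "gcd p p' * (q * q') = gcd (p * q * q') (p' * q' * q)"
    using gcd_mult_distrib_nat [of "q * q'" p p'] by (simp add: ac_simps)
  also have "\<dots> = gcd (p * q * q') (p * q * q)" using assms by simp
  also have "\<dots> = p * q * gcd q q'" by (simp only: gcd_mult_distrib_nat gcd.commute)
  finally have "gcd q q' * (gcd p p' * lcm q q') = gcd q q' * (p * q)"
    by (metis mult.assoc mult.commute prod_gcd_lcm_nat)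
  then show ?thesis using assms(2) by simp
qed

text \<open>\<open>d = p / gcd p p'\<close> is moved from \<open>p\<close> to \<open>q\<close>. The
  gcds with \<open>n\<close> survive because gcd distributes over lcm, so both conditions for moving
  \<open>d\<close> hold.\<close>

lemma iso_to_gcd_lcm:
  assumes P: "projective_reflection_group r n p q" and P': "projective_reflection_group r n p' q'"
    and pq: "p * q = p' * q'" and gcd: "gcd p n = gcd p' n" "gcd q n = gcd q' n"
  shows "projective_reflection_group r n (gcd p p') (lcm q q')"
    and "G_rpqn r p q n \<cong> G_rpqn r (gcd p p') (lcm q q') n"
proof -
  interpret P: projective_reflection_group r n p q by (rule P)
  interpret P': projective_reflection_group r n p' q' by (rule P')
  have prod: "gcd p p' * lcm q q' = p * q" by (rule gcd_mult_lcm_cross [OF pq P.q_pos])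
  show Q: "projective_reflection_group r n (gcd p p') (lcm q q')"
    using P.projective_reflection_group_axioms P'.projective_reflection_group_axioms prod
    by (auto simp: projective_reflection_group_def intro: dvd_trans)
  obtain d where d: "p = gcd p p' * d" by (meson dvdE gcd_dvd1)
  have "gcd p p' * lcm q q' = gcd p p' * (q * d)"
    using prod d by (metis mult.assoc mult.commute)
  then have l: "lcm q q' = q * d" using P.p_pos by simp
  have "gcd (gcd p p' * d) n = gcd (gcd p p') n"
    using gcd d by (metis gcd.assoc gcd.commute gcd.left_idem)
  moreover have "gcd (q * d) n = gcd q n"
  proof -
    have "gcd (lcm q q') n = lcm (gcd q n) (gcd q' n)"
      by (metis gcd.commute gcd_lcm_distrib)
    then show ?thesis using gcd l by simp
  qed
  ultimately show "G_rpqn r p q n \<cong> G_rpqn r (gcd p p') (lcm q q') n"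
    using iso_transfer_factor [of r n "gcd p p'" d q] P Q d l by simp
qed

lemma iso_if_gcds_eq:
  assumes P: "projective_reflection_group r n p q" and P': "projective_reflection_group r n p' q'"
    and pq: "p * q = p' * q'" and gcd: "gcd p n = gcd p' n" "gcd q n = gcd q' n"
  shows "G_rpqn r p q n \<cong> G_rpqn r p' q' n"
proof -
  have "G_rpqn r p q n \<cong> G_rpqn r (gcd p p') (lcm q q') n"
    by (rule iso_to_gcd_lcm [OF assms])
  moreover have "G_rpqn r p' q' n \<cong> G_rpqn r (gcd p p') (lcm q q') n"
    using iso_to_gcd_lcm(2) [OF P' P pq [symmetric] gcd [symmetric]]
    by (simp add: gcd.commute lcm.commute)
  then have "G_rpqn r (gcd p p') (lcm q q') n \<cong> G_rpqn r p' q' n"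
    by (rule group.iso_sym [OF projective_reflection_group.group_Q [OF P']])
  ultimately show ?thesis by (rule iso_trans)
qed

text \<open>The map is \<open>x j + \<beta> * x (1 - j)\<close>. The congruence
  \<open>\<beta> = 0\<close> modulo \<open>R\<close> makes it the identity there, and
  \<open>\<beta> = -1\<close> modulo \<open>2 ^ k\<close> makes it the difference of the
  coordinates. In the kernel this difference is congruent to \<open>c\<close>, a multiple of
  \<open>2 ^ k\<close>, so the coordinates agree modulo both factors.\<close>

lemma iso_rank_2_power_2:
  fixes k R p q :: nat
  assumes P: "projective_reflection_group (2 ^ k * R) 2 p (2 ^ k * q)"
    and P': "projective_reflection_group (2 ^ k * R) 2 (2 ^ k * p) q"
    and "odd R" "odd q" "p dvd R" "q dvd R"
  shows "G_rpqn (2 ^ k * R) p (2 ^ k * q) 2 \<cong> G_rpqn (2 ^ k * R) (2 ^ k * p) q 2"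
proof -
  interpret P: projective_reflection_group "2 ^ k * R" 2 p "2 ^ k * q" by (rule P)
  interpret P': projective_reflection_group "2 ^ k * R" 2 "2 ^ k * p" q by (rule P')
  have "coprime (int R) (2 ^ k)" using assms(3) by simp
  then obtain b where b: "[int R * b = - 1] (mod 2 ^ k)"
    using cong_solve_coprime_int [of "int R" "2 ^ k"] by (metis cong_minus_minus_iff mult_minus_right)
  \<comment> \<open>Chinese remainder element: divisible by \<open>R\<close> by construction and
    congruent to -1 modulo \<open>2 ^ k\<close> by the choice of \<open>b\<close>.\<close>
  define \<beta> where "\<beta> = int R * b"
  have b2: "2 ^ k dvd 1 + \<beta>" using b by (simp add: \<beta>_def cong_iff_dvd_diff add.commute)
  interpret coset_linear_map "2 ^ k * R" 2 p "2 ^ k * q" "2 ^ k * p" q "1 - \<beta>" "\<beta> * int p"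
  proof unfold_locales
    show "p * (2 ^ k * q) = 2 ^ k * p * q" by simp
    show "int p dvd \<beta> * int p * int q" by simp
    have "(1 - \<beta>) * int p + \<beta> * int p * int 2 = (1 + \<beta>) * int p" by (simp add: algebra_simps)
    then show "int (2 ^ k * p) dvd (1 - \<beta>) * int p + \<beta> * int p * int 2"
      using mult_dvd_mono [OF b2 dvd_refl, of "int p"] by simp
  qed
  have R_pos: "R > 0" and p_pos: "p > 0" using P.r_pos P.p_pos by simp_all
  obtain m where m: "R = q * m" using assms(6) by blast
  have "q > 0" using m R_pos by (auto intro: Nat.gr0I)
  have e: "2 ^ k * R div (2 ^ k * q) = m" using \<open>q > 0\<close> m by simp
  have e': "2 ^ k * R div q = 2 ^ k * m"
    using \<open>q > 0\<close> m by (simp add: mult.left_commute)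
  show ?thesis
  proof (rule iso_if_injective)
    fix x t assume x: "int p dvd (\<Sum>i<2. x i)"
      and T: "\<And>j. j < 2 \<Longrightarrow> [exponent_map x j = int (2 ^ k * R div q) * t] (mod int (2 ^ k * R))"
    obtain l where l: "x 0 + x 1 = int p * l" using x unfolding sum_less_2 by blast
    have T_eq: "exponent_map x j = (1 - \<beta>) * x j + \<beta> * (x 0 + x 1)" for j
      using p_pos l by (simp add: exponent_map_def sum_less_2)
    define c where "c = int (2 ^ k * R div q) * t"
    have T0: "2 ^ k * int R dvd x 0 + \<beta> * x 1 - c" and T1: "2 ^ k * int R dvd x 1 + \<beta> * x 0 - c"
      using T [of 0] T [of 1] by (simp_all add: T_eq c_def cong_iff_dvd_diff algebra_simps)
    have R_\<beta>: "int R dvd \<beta> * y" for y by (simp add: \<beta>_def)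
    have R0: "int R dvd x 0 - c"
      using dvd_diff [OF dvd_mult_right [OF T0] R_\<beta> [of "x 1"]] by (simp add: algebra_simps)
    have R1: "int R dvd x 1 - c"
      using dvd_diff [OF dvd_mult_right [OF T1] R_\<beta> [of "x 0"]] by (simp add: algebra_simps)
    have R01: "int R dvd x 1 - x 0" using dvd_diff [OF R1 R0] by simp
    have "2 ^ k dvd c" by (simp add: c_def e')
    \<comment> \<open>The expression is \<open>x 0 - x 1\<close>, written so that each of its three
      terms is visibly divisible by \<open>2 ^ k\<close>.\<close>
    have "2 ^ k dvd (1 + \<beta>) * x 0 - (x 1 + \<beta> * x 0 - c) - c"
      by (intro dvd_diff dvd_mult2 b2 dvd_mult_left [OF T1] \<open>2 ^ k dvd c\<close>)
    then have "2 ^ k dvd x 1 - x 0"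
      by (simp add: algebra_simps dvd_diff_commute)
    with R01 \<open>coprime (int R) (2 ^ k)\<close> have "2 ^ k * int R dvd x 1 - x 0"
      by (intro divides_mult) (simp_all add: coprime_commute)
    moreover have "int m dvd x 0"
    proof -
      have "int m dvd int R" "int m dvd c" by (simp_all add: m c_def e')
      from dvd_add [OF dvd_trans [OF this(1) R0] this(2)] show ?thesis by simp
    qed
    then obtain s where "x 0 = int m * s" by blast
    ultimately have "\<forall>j<2. [x j = int m * s] (mod int (2 ^ k * R))"
      by (simp add: all_less_2 cong_iff_dvd_diff)
    then show "\<exists>s. \<forall>j<2. [x j = int (2 ^ k * R div (2 ^ k * q)) * s] (mod int (2 ^ k * R))"
      unfolding e by blast
  qed
qed

lemma power_2_odd_decomposition:
  assumes "m > (0 :: nat)"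
  obtains k R where "m = 2 ^ k * R" "odd R"
proof -
  have "\<exists>k R. m = 2 ^ k * R \<and> odd R"
    using assms
  proof (induction m rule: less_induct)
    case (less m)
    show ?case
    proof (cases "even m")
      case True
      then obtain l where l: "m = 2 * l" by blast
      then obtain k R where "l = 2 ^ k * R" "odd R" using less.IH [of l] less.prems by auto
      then have "m = 2 ^ Suc k * R \<and> odd R" using l by simp
      then show ?thesis by blast
    next
      case False
      then have "m = 2 ^ 0 * m \<and> odd m" by simp
      then show ?thesis by blast
    qed
  qed
  then show thesis using that by blast
qed

lemma odd_dvd_power_2_mult:
  fixes a k R :: nat
  assumes "odd a" "a dvd 2 ^ k * R"
  shows "a dvd R"
proof -
  have "coprime a (2 ^ k)" using assms(1) by simp
  then show ?thesis using assms(2) by (simp add: coprime_dvd_mult_right_iff)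
qed

text \<open>In \<open>r = p * q * m = p' * q' * m\<close> the numbers \<open>p\<close>,
  \<open>q'\<close> and \<open>m\<close> are odd, so the full power \<open>2 ^ k\<close> in
  \<open>r\<close> divides both \<open>q\<close> and \<open>p'\<close>. With
  \<open>p' = 2 ^ k * a\<close>, the pairs \<open>(p, q)\<close> and \<open>(a, 2 ^ k * q')\<close>
  have equal gcds with 2, and it remains to move \<open>2 ^ k\<close> as a whole.\<close>

lemma iso_rank_2_swap:
  assumes P: "projective_reflection_group r 2 p q" and P': "projective_reflection_group r 2 p' q'"
    and pq: "p * q = p' * q'" and "p * q dvd r" "odd (r div (p * q))"
    and "odd p" "even p'" "odd q'"
  shows "G_rpqn r p q 2 \<cong> G_rpqn r p' q' 2"
proof -
  interpret P: projective_reflection_group r 2 p q by (rule P)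
  interpret P': projective_reflection_group r 2 p' q' by (rule P')
  obtain k R where r: "r = 2 ^ k * R" and R: "odd R"
    using power_2_odd_decomposition [OF P.r_pos] by blast
  define m where "m = r div (p * q)"
  have r_eq: "r = p * q * m" and r_eq': "r = p' * q' * m"
    using assms(4) pq by (simp_all add: m_def)
  have "2 ^ k dvd q * (p * m)" using r by (simp add: r_eq [symmetric] ac_simps) (metis dvd_triv_left r r_eq mult.commute mult.assoc)
  moreover have "coprime (2 ^ k) (p * m)" using assms(5,6) by (simp add: m_def)
  ultimately have "2 ^ k dvd q" by (simp add: coprime_dvd_mult_left_iff)
  have "2 ^ k dvd p' * (q' * m)" using r r_eq' by (metis dvd_triv_left mult.assoc)
  moreover have "coprime (2 ^ k) (q' * m)" using assms(5,8) by (simp add: m_def)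
  ultimately have "2 ^ k dvd p'" by (simp add: coprime_dvd_mult_left_iff)
  then obtain a where a: "p' = 2 ^ k * a" by blast
  have "a dvd R" using P'.p_dvd r a by simp
  then have "odd a" using R dvd_trans by blast
  then have "k > 0" using a assms(7) by (cases k) auto
  have "q' dvd R" using odd_dvd_power_2_mult assms(8) P'.q_dvd r by blast
  have Pm: "projective_reflection_group r 2 a (2 ^ k * q')"
  proof
    show "a dvd r" using \<open>a dvd R\<close> r by simp
    show "2 ^ k * q' dvd r" using \<open>q' dvd R\<close> r by simp
    show "a * (2 ^ k * q') dvd r * 2" using P'.pq_dvd a by (simp add: ac_simps)
  qed (use P.r_pos in auto)
  have odd_gcd: "gcd b 2 = 1" if "odd b" for b :: nat
    using that by (metis coprime_iff_gcd_eq_1 coprime_right_2_iff_odd)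
  have even_gcd: "gcd b 2 = 2" if "even b" for b :: nat
    using that by (rule gcd_nat.absorb2)
  have "even (2 ^ k * q')" using \<open>k > 0\<close> by simp
  moreover have "even q" using \<open>2 ^ k dvd q\<close> \<open>k > 0\<close> by (metis dvd_power dvd_trans)
  ultimately have "G_rpqn r p q 2 \<cong> G_rpqn r a (2 ^ k * q') 2"
    using \<open>odd p\<close> \<open>odd a\<close> pq a
    by (intro iso_if_gcds_eq P Pm) (simp_all add: odd_gcd even_gcd)
  also have "\<dots> \<cong> G_rpqn r (2 ^ k * a) q' 2"
    using Pm P' R \<open>odd q'\<close> \<open>a dvd R\<close> \<open>q' dvd R\<close> unfolding r a
    by (intro iso_rank_2_power_2)
  finally show ?thesis by (simp add: a)
qed

section \<open>Necessity of the conditions\<close>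

lemma gcds_eq_if_iso:
  assumes P: "projective_reflection_group r n p q" and P': "projective_reflection_group r n p' q'"
    and pq: "p * q = p' * q'" and "n \<ge> 3" and iso: "G_rpqn r p q n \<cong> G_rpqn r p' q' n"
  shows "gcd p n = gcd p' n" "gcd q n = gcd q' n"
proof -
  interpret P: projective_reflection_group r n p q by (rule P)
  interpret P': projective_reflection_group r n p' q' by (rule P')
  note cards = iso_card_center [OF P.group_Q P'.group_Q iso]
  have "card P.scalars = card P'.scalars"
    using cards(1) by (simp only: P.center_eq_scalars P'.center_eq_scalars \<open>n \<ge> 3\<close>)
  then have "r * gcd p n = r * gcd p' n"
    by (simp only: P.card_scalar_classes [symmetric] P'.card_scalar_classes [symmetric] pq)
  then show "gcd p n = gcd p' n" using P.r_pos by simp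
  let ?c = "card (derived (G_rpqn r p q n) (carrier (G_rpqn r p q n)))"
  have "r * gcd q n * ?c = r * gcd q' n * ?c"
    using cards(3) P.card_derived_Q P'.card_derived_Q \<open>n \<ge> 3\<close> by simp
  moreover have "?c \<noteq> 0"
    using P.card_derived_Q [OF \<open>n \<ge> 3\<close>] P.r_pos card_perm_derived_pos [of n] by (metis mult_0_right mult_is_0 neq0_conv power_not_zero)
  ultimately show "gcd q n = gcd q' n" using P.r_pos by simp
qed

lemma parity_product_if_iso_rank_2:
  assumes P: "projective_reflection_group r 2 p q" and P': "projective_reflection_group r 2 p' q'"
    and pq: "p * q = p' * q'" and iso: "G_rpqn r p q 2 \<cong> G_rpqn r p' q' 2"
    and "even p" "even q"
  shows "even p' \<and> even q'"
proof (rule ccontr)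
  interpret P: projective_reflection_group r 2 p q by (rule P)
  interpret P': projective_reflection_group r 2 p' q' by (rule P')
  assume odd: "\<not> (even p' \<and> even q')"
  have "2 * 2 dvd p * q" using assms(5,6) by (rule mult_dvd_mono)
  then have four: "2\<^sup>2 dvd p' * q'" using pq by (simp add: power2_eq_square)
  \<comment> \<open>One of \<open>p'\<close> and \<open>q'\<close> is odd, so 4 divides the other
    one, which divides \<open>r\<close>. The estimates for the centre need this.\<close>
  have "4 dvd r"
  proof (cases "even p'")
    case True
    then have "coprime (2\<^sup>2) q'"
      using odd by (simp only: coprime_power_left_iff coprime_left_2_iff_odd) simp
    then have "2\<^sup>2 dvd p'" using four coprime_dvd_mult_left_iff by blast
    then show ?thesis using P'.p_dvd dvd_trans by fastforce
  next
    case False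
    then have "coprime (2\<^sup>2) p'"
      by (simp only: coprime_power_left_iff coprime_left_2_iff_odd) simp
    then have "2\<^sup>2 dvd q'" using four coprime_dvd_mult_right_iff by blast
    then show ?thesis using P'.q_dvd dvd_trans by fastforce
  qed
  have "2 * r < p * q * card (center (G_rpqn r p q 2))"
    using P.card_center_rank_2_gt \<open>4 dvd r\<close> assms by simp
  also have "\<dots> = p' * q' * card (center (G_rpqn r p' q' 2))"
    using iso_card_center(1) [OF P.group_Q P'.group_Q iso] pq by simp
  also have "\<dots> \<le> 2 * r"
    using P'.card_center_rank_2_le \<open>4 dvd r\<close> odd by simp
  finally show False by simp
qed

text \<open>The standing condition only gives \<open>p * q dvd 2 * r\<close>; integrality of the
  quotient follows since \<open>p\<close> is odd and the 2-part of \<open>q\<close> divides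
  \<open>r\<close>. If the quotient were even, at least three central classes of order at most 2
  would face at most two.\<close>

lemma odd_quotient_if_iso_rank_2:
  assumes P: "projective_reflection_group r 2 p q" and P': "projective_reflection_group r 2 p' q'"
    and pq: "p * q = p' * q'" and iso: "G_rpqn r p q 2 \<cong> G_rpqn r p' q' 2"
    and "odd p" "even p'" "odd q'"
  shows "p * q dvd r" "odd (r div (p * q))"
proof -
  interpret P: projective_reflection_group r 2 p q by (rule P)
  interpret P': projective_reflection_group r 2 p' q' by (rule P')
  have "even (p * q)" using assms by simp
  then have "even q" using \<open>odd p\<close> by simp
  obtain k a where q: "q = 2 ^ k * a" and "odd a"
    using power_2_odd_decomposition [OF P.q_pos] by blast
  have "k > 0" using q \<open>even q\<close> \<open>odd a\<close> by (cases k) auto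
  obtain b where b: "r = 2 ^ k * b" using P.q_dvd q by (metis dvd_def mult.assoc)
  have "p * a dvd b"
  proof -
    have "2 ^ k * (p * a) dvd 2 ^ k * (b * 2)" using P.pq_dvd q b by (simp add: ac_simps)
    then have "p * a dvd 2 * b" by (simp add: mult.commute)
    then show ?thesis using odd_dvd_power_2_mult [of "p * a" 1 b] \<open>odd p\<close> \<open>odd a\<close> by simp
  qed
  then have "2 ^ k * (p * a) dvd 2 ^ k * b" by simp
  then show dvd: "p * q dvd r" by (simp add: q b ac_simps)
  show "odd (r div (p * q))"
  proof
    assume "even (r div (p * q))"
    then have *: "2 * (p * q) dvd r" using dvd
      by (metis dvd_div_mult_self dvd_refl mult_dvd_mono)
    have "2 * 2 dvd 2 * (p * q)" using \<open>even q\<close> by simp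
    then have "4 dvd r" using * by (metis dvd_trans mult_2 numeral_Bit0)
    have "3 \<le> card {z \<in> center (G_rpqn r p q 2). z \<otimes>\<^bsub>G_rpqn r p q 2\<^esub> z = \<one>\<^bsub>G_rpqn r p q 2\<^esub>}"
      using P.card_central_involutions_ge * \<open>odd p\<close> \<open>even q\<close> by simp
    also have "\<dots> = card {z \<in> center (G_rpqn r p' q' 2). z \<otimes>\<^bsub>G_rpqn r p' q' 2\<^esub> z = \<one>\<^bsub>G_rpqn r p' q' 2\<^esub>}"
      by (rule iso_card_center(2) [OF P.group_Q P'.group_Q iso])
    also have "\<dots> \<le> 2"
      using P'.card_central_involutions_le \<open>4 dvd r\<close> \<open>odd q'\<close> by simp
    finally show False by simp
  qed
qed

text \<open>That \<open>r / (p * q)\<close> is an odd integer is expressed by a divisibility and the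
  parity of the quotient, because for \<open>n = 2\<close> the hypotheses yield only
  \<open>p * q dvd 2 * r\<close>.\<close>

theorem theorem1p3:
  fixes r n p p' q q' :: nat
  assumes "r > 0" and "n > 0"
    and "p dvd r" and "p' dvd r" and "q dvd r" and "q' dvd r"
    and "p * q = p' * q'" and "p * q dvd r * n"
  shows "G_rpqn r p q n \<cong> G_rpqn r p' q' n \<longleftrightarrow>
    (gcd p n = gcd p' n \<and> gcd q n = gcd q' n) \<or>
    (n = 2 \<and> odd (p + p') \<and> odd (q + q') \<and> p * q dvd r \<and> odd (r div (p * q)))"
proof -
  have P: "projective_reflection_group r n p q" and P': "projective_reflection_group r n p' q'"
    using assms by (simp_all add: projective_reflection_group_def)
  note sym = group.iso_sym [OF projective_reflection_group.group_Q]
  note pq = \<open>p * q = p' * q'\<close>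
  have "even (p * q) \<longleftrightarrow> even (p' * q')" using pq by simp
  then have parity: "even p \<or> even q \<longleftrightarrow> even p' \<or> even q'" by simp
  show ?thesis
  proof
    assume iso: "G_rpqn r p q n \<cong> G_rpqn r p' q' n"
    consider "n = 1" | "n = 2" | "n \<ge> 3" using \<open>n > 0\<close> by linarith
    then show "(gcd p n = gcd p' n \<and> gcd q n = gcd q' n) \<or>
      (n = 2 \<and> odd (p + p') \<and> odd (q + q') \<and> p * q dvd r \<and> odd (r div (p * q)))"
    proof cases
      case 2
      note P = P [unfolded 2] and P' = P' [unfolded 2] and iso = iso [unfolded 2]
      have gcd_2: "gcd a 2 = gcd b 2" if "even a \<longleftrightarrow> even b" for a b :: nat
        using that by (metis coprime_iff_gcd_eq_1 coprime_right_2_iff_odd gcd_nat.absorb2)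
      \<comment> \<open>Together with \<open>parity\<close> this leaves two possibilities: the
        parities of \<open>p\<close> and \<open>q\<close> are unchanged, or one of them is odd, the
        other even, and they are exchanged.\<close>
      have both: "even p \<and> even q \<longleftrightarrow> even p' \<and> even q'"
        using parity_product_if_iso_rank_2 [OF P P' pq iso]
          parity_product_if_iso_rank_2 [OF P' P pq [symmetric] sym [OF P iso]] by blast
      show ?thesis
      proof (cases "even p \<longleftrightarrow> even p'")
        case True
        then have "even q \<longleftrightarrow> even q'" using parity both by blast
        with True show ?thesis using gcd_2 2 by blast
      next
        case False
        then have q: "even q \<noteq> even q'" using parity both by blast
        have "p * q dvd r \<and> odd (r div (p * q))"
        proof (cases "odd p")
          case True
          then show ?thesis
            using odd_quotient_if_iso_rank_2 [OF P P' pq iso] False both parity by blast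
        next
          case p: False
          then show ?thesis
            using odd_quotient_if_iso_rank_2 [OF P' P pq [symmetric] sym [OF P iso]] False both parity pq
            by metis
        qed
        then show ?thesis using False q 2 by simp
      qed
    \<comment> \<open>For \<open>n = 1\<close> all gcds are 1; for \<open>n \<ge> 3\<close> the two
      orders decide.\<close>
    qed (use gcds_eq_if_iso [OF P P' pq _ iso] in auto)
  next
    assume "(gcd p n = gcd p' n \<and> gcd q n = gcd q' n) \<or>
      (n = 2 \<and> odd (p + p') \<and> odd (q + q') \<and> p * q dvd r \<and> odd (r div (p * q)))"
    then show "G_rpqn r p q n \<cong> G_rpqn r p' q' n"
    proof (elim disjE conjE)
      assume "gcd p n = gcd p' n" "gcd q n = gcd q' n"
      then show ?thesis by (rule iso_if_gcds_eq [OF P P' pq])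
    next
      assume n: "n = 2" and odd: "odd (p + p')" "odd (q + q')"
        and dvd: "p * q dvd r" "odd (r div (p * q))"
      note P = P [unfolded n] and P' = P' [unfolded n]
      show ?thesis
      proof (cases "odd p")
        case True
        then show ?thesis
          using iso_rank_2_swap [OF P P' pq dvd] odd parity n by auto
      next
        case False
        then have "G_rpqn r p' q' 2 \<cong> G_rpqn r p q 2"
          using iso_rank_2_swap [OF P' P pq [symmetric]] dvd odd parity pq by auto
        then show ?thesis unfolding n by (rule sym [OF P'])
      qed
    qed
  qed
qed

end
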